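(* Let $\Omega\subseteq\mathbb{C}$ be an open set with $0\in\Omega$, and let $\overline\Omega$ denote its closure in $\mathbb{C}$. Let $F\subseteq\mathbb{N}\times\mathbb{N}$ be a set which contains a sequence $(\widetilde p_m,\widetilde q_m)_{m}$ with $\widetilde p_m\to+\infty$ and $\widetilde q_m\to+\infty$. Let $B_F$ be the set of all $f\in A^\infty(\Omega)$ for which there exists a sequence $(p_m,q_m)_m$ in $F$ such that $f\in D_{p_m,q_m}$ for all $m$, and such that for every compact set $K\subseteq\overline\Omega$ and every $l=0,1,2,\ldots$ one has $[p_m/q_m]_f^{(l)}\to f^{(l)}$ uniformly on $K$ as $m\to\infty$. Let $X$ be the closure of $H(\overline\Omega)$ in $A^\infty(\Omega)$, with the relative topology. Then $B_F\cap X$ is a dense $G_\delta$ subset of $X$. (Hence $B_F\neq\emptyset$.)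
   Context: $\mathbb{N}=\{0,1,2,\ldots\}$. $\Delta(0,r)=\{z\in\mathbb{C}:|z|<r\}$. **The space $A^\infty(\Omega)$.** $A^\infty(\Omega)$ is the set of holomorphic functions $f$ on $\Omega$ such that for every $l=0,1,2,\ldots$ the derivative $f^{(l)}$ extends continuously to $\overline\Omega$ (the extension is again denoted $f^{(l)}$). For $n\ge 1$ and $l\ge 0$ put $\|f-g\|_{l,n}=\sup_{z\in\overline\Omega\cap\overline{\Delta(0,n)}}|f^{(l)}(z)-g^{(l)}(z)|$. $A^\infty(\Omega)$ carries the complete metric $\rho(f,g)=\sum_{l=0}^\infty\sum_{n=1}^\infty 2^{-(l+n)}\min\{\|f-g\|_{l,n},1\}$; convergence means uniform convergence of every derivative on every compact subset of $\overline\Omega$. **The space $H(\overline\Omega)$.** $H(\overline\Omega)$ is the set of functions holomorphic in some open set (depending on the function) containing $\overline\Omega$. It is regarded, by restriction to $\Omega$, as a subset of $A^\infty(\Omega)$. **Padé approximants.** Let $f$ be holomorphic near $0$ with Taylor series $\sum_{v\ge0}a_vz^v$, and set $a_i=0$ for $i<0$. For $p,q\in\mathbb{N}$, a Padé approximant $[p/q]_f$ is a rational function $\frac{\sum_{v=0}^p n_vz^v}{\sum_{v=0}^q d_vz^v}$ with $d_0=1$ whose Taylor coefficients $b_v$ at $0$ satisfy $b_v=a_v$ for $v=0,\ldots,p+q$. For $q\ge1$, $f\in D_{p,q}$ means that the $q\times q$ determinant $\det(a_{p-q+i+j-1})_{1\le i,j\le q}$ is nonzero; in this case $[p/q]_f$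 exists and is unique. For $q=0$, every such $f$ belongs to $D_{p,0}$, and $[p/0]_f=\sum_{v=0}^p a_vz^v$. **Convention on poles.** Uniform convergence of $[p_m/q_m]_f^{(l)}$ on $K$ is understood with $|[p_m/q_m]_f^{(l)}-f^{(l)}|=\infty$ at poles, so in particular $[p_m/q_m]_f$ has no poles in $K$ for all sufficiently large $m$. *)

theory Defs
  imports "HOL-Complex_Analysis.Complex_Analysis" "Jordan_Normal_Form.Determinant"
begin

text \<open>
  Elements of \<open>A\<^sup>\<infinity>(\<Omega>)\<close> are functions on \<open>\<Omega>\<close>. They are represented by total functions that are
  \<^term>\<open>undefined\<close> off \<open>\<Omega>\<close>, so that HOL equality is equality on \<open>\<Omega>\<close>. Iterated derivatives at
  points of the open set \<open>\<Omega>\<close> do not see the values off \<open>\<Omega>\<close>.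
\<close>

definition A_infty :: "complex set \<Rightarrow> (complex \<Rightarrow> complex) set" where
  "A_infty \<Omega> = {f \<in> extensional \<Omega>. f holomorphic_on \<Omega> \<and>
     (\<forall>l. \<exists>g. continuous_on (closure \<Omega>) g \<and> (\<forall>z\<in>\<Omega>. g z = (deriv ^^ l) f z))}"

text \<open>
  The continuous extension of \<open>f\<^sup>(\<^sup>l\<^sup>)\<close> to \<open>closure \<Omega>\<close>; see \<open>A_infty_deriv_eq\<close> and
  \<open>continuous_on_A_infty_deriv\<close> below.
\<close>

definition A_infty_deriv :: "complex set \<Rightarrow> nat \<Rightarrow> (complex \<Rightarrow> complex) \<Rightarrow> complex \<Rightarrow> complex" where
  "A_infty_deriv \<Omega> l f z = Lim (at z within \<Omega>) ((deriv ^^ l) f)"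

definition A_infty_dist_ln ::
    "complex set \<Rightarrow> nat \<Rightarrow> nat \<Rightarrow> (complex \<Rightarrow> complex) \<Rightarrow> (complex \<Rightarrow> complex) \<Rightarrow> real" where
  "A_infty_dist_ln \<Omega> l n f g =
     (SUP z \<in> closure \<Omega> \<inter> cball 0 (real n). cmod (A_infty_deriv \<Omega> l f z - A_infty_deriv \<Omega> l g z))"

text \<open>
  The sum over \<open>n \<ge> 1\<close> is indexed by \<^term>\<open>Suc n\<close>. The value off \<^const>\<open>A_infty\<close> is irrelevant for
  the topology; it is fixed to 0 because \<^locale>\<open>Metric_space\<close> demands a nonnegative and symmetric
  distance on the whole type.
\<close>

definition A_infty_rho :: "complex set \<Rightarrow> (complex \<Rightarrow> complex) \<Rightarrow> (complex \<Rightarrow> complex) \<Rightarrow> real" where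
  "A_infty_rho \<Omega> f g =
     (if f \<in> A_infty \<Omega> \<and> g \<in> A_infty \<Omega>
      then \<Sum>l. \<Sum>n. (1/2) ^ (l + Suc n) * min (A_infty_dist_ln \<Omega> l (Suc n) f g) 1
      else 0)"

definition A_infty_topology :: "complex set \<Rightarrow> (complex \<Rightarrow> complex) topology" where
  "A_infty_topology \<Omega> = Metric_space.mtopology (A_infty \<Omega>) (A_infty_rho \<Omega>)"

definition H_closure :: "complex set \<Rightarrow> (complex \<Rightarrow> complex) set" where
  "H_closure \<Omega> = {restrict f \<Omega> | f. \<exists>U. open U \<and> closure \<Omega> \<subseteq> U \<and> f holomorphic_on U}"

definition taylor_coeff :: "(complex \<Rightarrow> complex) \<Rightarrow> int \<Rightarrow> complex" where
  "taylor_coeff f k = (if k < 0 then 0 else fps_nth (fps_expansion f 0) (nat k))"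

text \<open>
  Rational functions are total functions with removable singularities removed, so that a rational
  function does not depend on the fraction \<open>N / D\<close> representing it. Their values at poles are 0;
  poles are detected by \<^const>\<open>is_pole\<close>.
\<close>

definition is_pade :: "nat \<Rightarrow> nat \<Rightarrow> (complex \<Rightarrow> complex) \<Rightarrow> (complex \<Rightarrow> complex) \<Rightarrow> bool" where
  "is_pade p q f r \<longleftrightarrow>
     (\<exists>N D :: complex poly. degree N \<le> p \<and> degree D \<le> q \<and> coeff D 0 = 1 \<and>
        r = remove_sings (\<lambda>z. poly N z / poly D z)) \<and>
     (\<forall>v\<le>p+q. fps_nth (fps_expansion r 0) v = taylor_coeff f (int v))"

definition pade :: "nat \<Rightarrow> nat \<Rightarrow> (complex \<Rightarrow> complex) \<Rightarrow> complex \<Rightarrow> complex" where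
  "pade p q f = (THE r. is_pade p q f r)"

text \<open>
  Matrix indices start at 0, which shifts \<open>p - q + i + j - 1\<close> to \<open>p - q + i + j + 1\<close>.
\<close>

definition pade_D :: "nat \<Rightarrow> nat \<Rightarrow> (complex \<Rightarrow> complex) set" where
  "pade_D p q = {f. q = 0 \<or>
     Determinant.det (Matrix.mat q q
       (\<lambda>(i, j). taylor_coeff f (int p - int q + int i + int j + 1))) \<noteq> 0}"

text \<open>
  Uniform convergence of \<open>r\<^sub>m\<^sup>(\<^sup>l\<^sup>)\<close> to \<open>g\<close> on \<open>K\<close>, where the error counts as infinite at poles.
\<close>

definition uniform_limit_deriv ::
    "complex set \<Rightarrow> nat \<Rightarrow> (nat \<Rightarrow> complex \<Rightarrow> complex) \<Rightarrow> (complex \<Rightarrow> complex) \<Rightarrow> bool" where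
  "uniform_limit_deriv K l r g \<longleftrightarrow>
     (\<forall>\<^sub>F m in sequentially. \<forall>z\<in>K. \<not> is_pole (r m) z) \<and>
     uniform_limit K (\<lambda>m. (deriv ^^ l) (r m)) g sequentially"

definition B_F :: "complex set \<Rightarrow> (nat \<times> nat) set \<Rightarrow> (complex \<Rightarrow> complex) set" where
  "B_F \<Omega> F = {f \<in> A_infty \<Omega>. \<exists>p q :: nat \<Rightarrow> nat.
     (\<forall>m. (p m, q m) \<in> F \<and> f \<in> pade_D (p m) (q m)) \<and>
     (\<forall>K l. compact K \<and> K \<subseteq> closure \<Omega> \<longrightarrow>
        uniform_limit_deriv K l (\<lambda>m. pade (p m) (q m) f) (A_infty_deriv \<Omega> l f))}"


lemma A_infty_deriv_unique:
  assumes "open \<Omega>" "continuous_on (closure \<Omega>) g" "\<And>z. z \<in> \<Omega> \<Longrightarrow> g z = (deriv ^^ l) f z"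
    "z \<in> closure \<Omega>"
  shows "A_infty_deriv \<Omega> l f z = g z"
proof -
  have "z islimpt \<Omega>"
    using assms(1,4) by (auto simp: closure_def intro: interior_limit_point simp: interior_open)
  then have nt: "at z within \<Omega> \<noteq> bot"
    by (simp add: trivial_limit_within)
  have "(g \<longlongrightarrow> g z) (at z within closure \<Omega>)"
    using assms(2,4) by (simp add: continuous_on)
  then have "(g \<longlongrightarrow> g z) (at z within \<Omega>)"
    by (rule tendsto_within_subset[OF _ closure_subset])
  moreover have "\<forall>\<^sub>F w in at z within \<Omega>. g w = (deriv ^^ l) f w"
    using assms(3) by (simp add: eventually_at_filter)
  ultimately have "((deriv ^^ l) f \<longlongrightarrow> g z) (at z within \<Omega>)"
    by (simp add: tendsto_cong)
  then show ?thesis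
    unfolding A_infty_deriv_def by (rule tendsto_Lim[OF nt])
qed

lemma continuous_on_A_infty_deriv:
  assumes "open \<Omega>" "f \<in> A_infty \<Omega>"
  shows "continuous_on (closure \<Omega>) (A_infty_deriv \<Omega> l f)"
proof -
  obtain g where g: "continuous_on (closure \<Omega>) g" "\<And>z. z \<in> \<Omega> \<Longrightarrow> g z = (deriv ^^ l) f z"
    using assms(2) unfolding A_infty_def by blast
  show ?thesis
    by (rule continuous_on_eq[OF g(1)]) (rule A_infty_deriv_unique[OF assms(1) g, symmetric])
qed

lemma A_infty_deriv_eq:
  assumes "open \<Omega>" "f \<in> A_infty \<Omega>" "z \<in> \<Omega>"
  shows "A_infty_deriv \<Omega> l f z = (deriv ^^ l) f z"
proof -
  obtain g where g: "continuous_on (closure \<Omega>) g" "\<And>z. z \<in> \<Omega> \<Longrightarrow> g z = (deriv ^^ l) f z"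
    using assms(2) unfolding A_infty_def by blast
  show ?thesis
    using A_infty_deriv_unique[OF assms(1) g, of z] g(2)[OF assms(3)] assms(3) closure_subset[of \<Omega>]
    by auto
qed

lemma A_infty_dist_ln_upper:
  assumes "open \<Omega>" "f \<in> A_infty \<Omega>" "g \<in> A_infty \<Omega>" "z \<in> closure \<Omega>" "cmod z \<le> real n"
  shows "cmod (A_infty_deriv \<Omega> l f z - A_infty_deriv \<Omega> l g z) \<le> A_infty_dist_ln \<Omega> l n f g"
proof -
  have "compact (closure \<Omega> \<inter> cball 0 (real n))"
    by (simp add: closed_Int_compact)
  moreover have "continuous_on (closure \<Omega> \<inter> cball 0 (real n))
      (\<lambda>z. cmod (A_infty_deriv \<Omega> l f z - A_infty_deriv \<Omega> l g z))"
    using continuous_on_A_infty_deriv[OF assms(1,2)] continuous_on_A_infty_deriv[OF assms(1,3)]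
    by (intro continuous_intros) (auto intro: continuous_on_subset)
  ultimately have "bdd_above ((\<lambda>z. cmod (A_infty_deriv \<Omega> l f z - A_infty_deriv \<Omega> l g z)) `
      (closure \<Omega> \<inter> cball 0 (real n)))"
    by (meson bounded_imp_bdd_above compact_continuous_image compact_imp_bounded)
  then show ?thesis
    unfolding A_infty_dist_ln_def using assms(4,5) by (intro cSUP_upper) auto
qed

lemma A_infty_dist_ln_least:
  assumes "0 \<in> \<Omega>"
    and "\<And>z. z \<in> closure \<Omega> \<Longrightarrow> cmod z \<le> real n \<Longrightarrow>
      cmod (A_infty_deriv \<Omega> l f z - A_infty_deriv \<Omega> l g z) \<le> B"
  shows "A_infty_dist_ln \<Omega> l n f g \<le> B"
proof -
  have "0 \<in> closure \<Omega> \<inter> cball 0 (real n)"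
    using assms(1) closure_subset by auto
  then show ?thesis
    unfolding A_infty_dist_ln_def using assms(2) by (intro cSUP_least) auto
qed

lemma A_infty_dist_ln_nonneg:
  assumes "open \<Omega>" "0 \<in> \<Omega>" "f \<in> A_infty \<Omega>" "g \<in> A_infty \<Omega>"
  shows "0 \<le> A_infty_dist_ln \<Omega> l n f g"
proof -
  have "cmod (A_infty_deriv \<Omega> l f 0 - A_infty_deriv \<Omega> l g 0) \<le> A_infty_dist_ln \<Omega> l n f g"
    using assms closure_subset by (intro A_infty_dist_ln_upper) auto
  then show ?thesis
    using norm_ge_zero order_trans by blast
qed

context
  fixes \<Omega> :: "complex set"
  assumes \<Omega>: "open \<Omega>" "0 \<in> \<Omega>"
begin

private definition rho_term :: "(complex \<Rightarrow> complex) \<Rightarrow> (complex \<Rightarrow> complex) \<Rightarrow> nat \<Rightarrow> nat \<Rightarrow> real" where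
  "rho_term f g l n = (1/2) ^ (l + Suc n) * min (A_infty_dist_ln \<Omega> l (Suc n) f g) 1"

private lemma rho_term_bounds:
  assumes "f \<in> A_infty \<Omega>" "g \<in> A_infty \<Omega>"
  shows "0 \<le> rho_term f g l n" "rho_term f g l n \<le> (1/2) ^ l * (1/2) ^ Suc n"
proof -
  show "0 \<le> rho_term f g l n"
    unfolding rho_term_def using A_infty_dist_ln_nonneg[OF \<Omega> assms] by simp
  have "rho_term f g l n \<le> (1/2) ^ (l + Suc n) * 1"
    unfolding rho_term_def by (intro mult_left_mono) auto
  then show "rho_term f g l n \<le> (1/2) ^ l * (1/2) ^ Suc n"
    by (simp add: power_add)
qed

private lemma half_sums: "(\<lambda>n. (1/2::real) ^ l * (1/2) ^ Suc n) sums (1/2) ^ l"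
  using sums_mult[OF power_half_series, of "(1/2) ^ l"] by simp

private lemma rho_summable_inner:
  assumes "f \<in> A_infty \<Omega>" "g \<in> A_infty \<Omega>"
  shows "summable (rho_term f g l)"
proof (rule summable_comparison_test'[OF sums_summable[OF half_sums], of 0])
  show "norm (rho_term f g l n) \<le> (1/2) ^ l * (1/2) ^ Suc n" for n
    using rho_term_bounds[OF assms, of l n] by (simp only: real_norm_def abs_of_nonneg)
qed

private lemma rho_inner_bounds:
  assumes "f \<in> A_infty \<Omega>" "g \<in> A_infty \<Omega>"
  shows "0 \<le> suminf (rho_term f g l)" "suminf (rho_term f g l) \<le> (1/2) ^ l"
proof -
  show "0 \<le> suminf (rho_term f g l)"
    by (rule suminf_nonneg[OF rho_summable_inner[OF assms] rho_term_bounds(1)[OF assms]])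
  have "suminf (rho_term f g l) \<le> (\<Sum>n. (1/2::real) ^ l * (1/2) ^ Suc n)"
    by (rule suminf_le[OF rho_term_bounds(2)[OF assms] rho_summable_inner[OF assms]
          sums_summable[OF half_sums]])
  then show "suminf (rho_term f g l) \<le> (1/2) ^ l"
    unfolding sums_unique[OF half_sums, symmetric] .
qed

private lemma rho_summable_outer:
  assumes "f \<in> A_infty \<Omega>" "g \<in> A_infty \<Omega>"
  shows "summable (\<lambda>l. suminf (rho_term f g l))"
proof (rule summable_comparison_test'[of "\<lambda>l. (1/2::real) ^ l" 0])
  show "summable (\<lambda>l. (1/2::real) ^ l)"
    by (rule summable_geometric) simp
  show "norm (suminf (rho_term f g l)) \<le> (1/2) ^ l" for l
    using rho_inner_bounds[OF assms, of l] by (simp only: real_norm_def abs_of_nonneg)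
qed

private lemma rho_eq:
  assumes "f \<in> A_infty \<Omega>" "g \<in> A_infty \<Omega>"
  shows "A_infty_rho \<Omega> f g = (\<Sum>l. suminf (rho_term f g l))"
  unfolding A_infty_rho_def rho_term_def using assms by (simp only: if_True simp_thms)

lemma Metric_space_A_infty: "Metric_space (A_infty \<Omega>) (A_infty_rho \<Omega>)"
proof
  fix f g
  show "0 \<le> A_infty_rho \<Omega> f g"
  proof (cases "f \<in> A_infty \<Omega> \<and> g \<in> A_infty \<Omega>")
    case True
    then have fg: "f \<in> A_infty \<Omega>" "g \<in> A_infty \<Omega>"
      by auto
    show ?thesis
      unfolding rho_eq[OF fg] by (rule suminf_nonneg[OF rho_summable_outer[OF fg] rho_inner_bounds(1)[OF fg]])
  next
    case False
    then have "A_infty_rho \<Omega> f g = 0"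
      unfolding A_infty_rho_def by (rule if_not_P)
    then show ?thesis
      by simp
  qed
  show "A_infty_rho \<Omega> f g = A_infty_rho \<Omega> g f"
    unfolding A_infty_rho_def A_infty_dist_ln_def by (auto simp: norm_minus_commute)
next
  fix f g
  assume fg: "f \<in> A_infty \<Omega>" "g \<in> A_infty \<Omega>"
  show "A_infty_rho \<Omega> f g = 0 \<longleftrightarrow> f = g"
  proof
    assume "A_infty_rho \<Omega> f g = 0"
    then have "suminf (rho_term f g 0) = 0"
      using suminf_eq_zero_iff[OF rho_summable_outer[OF fg]] rho_inner_bounds(1)[OF fg] rho_eq[OF fg]
      by auto
    then have "rho_term f g 0 n = 0" for n
      using suminf_eq_zero_iff[OF rho_summable_inner[OF fg]] rho_term_bounds(1)[OF fg] by auto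
    then have "min (A_infty_dist_ln \<Omega> 0 (Suc n) f g) 1 = 0" for n
      unfolding rho_term_def by (simp del: power_Suc)
    then have z: "A_infty_dist_ln \<Omega> 0 (Suc n) f g = 0" for n
      by (metis min_def zero_neq_one)
    have "f z = g z" if "z \<in> \<Omega>" for z
    proof -
      obtain n where "cmod z \<le> real n"
        using real_arch_simple by blast
      then have "cmod z \<le> real (Suc n)"
        by simp
      then have "cmod (A_infty_deriv \<Omega> 0 f z - A_infty_deriv \<Omega> 0 g z) \<le> 0"
        by (rule A_infty_dist_ln_upper[OF \<Omega>(1) fg subsetD[OF closure_subset that], of "Suc n" 0,
              unfolded z])
      then show ?thesis
        using A_infty_deriv_eq[OF \<Omega>(1) fg(1) that, of 0] A_infty_deriv_eq[OF \<Omega>(1) fg(2) that, of 0]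
        by simp
    qed
    then show "f = g"
      using fg by (intro extensionalityI[of f \<Omega> g]) (simp_all add: A_infty_def)
  next
    assume "f = g"
    have "0 \<in> closure \<Omega> \<inter> cball 0 (real n)" for n
      using \<Omega>(2) closure_subset by auto
    then have "closure \<Omega> \<inter> cball 0 (real n) \<noteq> {}" for n
      by (metis empty_iff)
    then have "A_infty_dist_ln \<Omega> l n f g = 0" for l n
      unfolding A_infty_dist_ln_def \<open>f = g\<close> by simp
    then show "A_infty_rho \<Omega> f g = 0"
      unfolding A_infty_rho_def by simp
  qed
next
  fix f g h
  assume fgh: "f \<in> A_infty \<Omega>" "g \<in> A_infty \<Omega>" "h \<in> A_infty \<Omega>"
  note fg = fgh(1,2) and gh = fgh(2,3) and fh = fgh(1,3)
  have tri: "A_infty_dist_ln \<Omega> l n f h \<le> A_infty_dist_ln \<Omega> l n f g + A_infty_dist_ln \<Omega> l n g h" for l n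
  proof (rule A_infty_dist_ln_least[OF \<Omega>(2)])
    fix z assume z: "z \<in> closure \<Omega>" "cmod z \<le> real n"
    show "cmod (A_infty_deriv \<Omega> l f z - A_infty_deriv \<Omega> l h z)
        \<le> A_infty_dist_ln \<Omega> l n f g + A_infty_dist_ln \<Omega> l n g h"
      using A_infty_dist_ln_upper[OF \<Omega>(1) fg z] A_infty_dist_ln_upper[OF \<Omega>(1) gh z]
      by (intro norm_diff_triangle_le[of _ "A_infty_deriv \<Omega> l g z"])
  qed
  have "min (A_infty_dist_ln \<Omega> l n f h) 1
      \<le> min (A_infty_dist_ln \<Omega> l n f g) 1 + min (A_infty_dist_ln \<Omega> l n g h) 1" for l n
    using A_infty_dist_ln_nonneg[OF \<Omega> fg, of l n] A_infty_dist_ln_nonneg[OF \<Omega> gh, of l n]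
      tri[of l n] by linarith
  then have le: "rho_term f h l n \<le> rho_term f g l n + rho_term g h l n" for l n
    unfolding rho_term_def distrib_left[symmetric] by (intro mult_left_mono) auto
  have "suminf (rho_term f h l) \<le> (\<Sum>n. rho_term f g l n + rho_term g h l n)" for l
    by (rule suminf_le[OF le rho_summable_inner[OF fh]
          summable_add[OF rho_summable_inner[OF fg] rho_summable_inner[OF gh]]])
  then have "suminf (rho_term f h l) \<le> suminf (rho_term f g l) + suminf (rho_term g h l)" for l
    unfolding suminf_add[OF rho_summable_inner[OF fg] rho_summable_inner[OF gh], symmetric] .
  then have "(\<Sum>l. suminf (rho_term f h l)) \<le> (\<Sum>l. suminf (rho_term f g l) + suminf (rho_term g h l))"
    by (rule suminf_le[OF _ rho_summable_outer[OF fh]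
          summable_add[OF rho_summable_outer[OF fg] rho_summable_outer[OF gh]]])
  then show "A_infty_rho \<Omega> f h \<le> A_infty_rho \<Omega> f g + A_infty_rho \<Omega> g h"
    unfolding rho_eq[OF fg] rho_eq[OF gh] rho_eq[OF fh]
      suminf_add[OF rho_summable_outer[OF fg] rho_summable_outer[OF gh]] .
qed

end

end

theory Submission
  imports Defs "HOL-Computational_Algebra.Fundamental_Theorem_Algebra"
begin

text \<open>
  Since the sequence \<open>(p\<^sub>m, q\<^sub>m)\<close> may be constant, a rational function \<open>N / D\<close> in lowest terms with
  \<open>degree N = p\<close>, \<open>degree D \<le> q\<close>, \<open>(p, q) \<in> F\<close> and no poles in \<open>closure \<Omega>\<close> lies in \<open>B_F\<close>: it belongs
  to \<open>D\<^sub>p\<^sub>,\<^sub>q\<close> and is its own Pade approximant. Such functions approximate every function holomorphic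
  near \<open>closure \<Omega>\<close>: Runge's theorem yields rational functions with poles off \<open>closure \<Omega>\<close>, and adding
  \<open>c z\<^sup>p\<^sup>-\<^sup>d\<close> with \<open>d = degree D\<close> and small \<open>c \<noteq> 0\<close> gives the numerator the exact degree \<open>p\<close>. So
  density needs neither Baire's theorem nor completeness. On the other hand \<open>B_F\<close> is an intersection
  over \<open>M\<close> of unions over \<open>(p, q) \<in> F\<close> of the sets where \<open>[p/q]\<^sub>f\<close> is close to \<open>f\<close> on a compact set
  depending on \<open>M\<close>. These sets are open, because the coefficients of \<open>[p/q]\<^sub>f\<close> depend continuously on
  the Taylor coefficients, and because numerator and denominator have no common root, so that being
  free of poles is a condition on the denominator.
\<close>

section \<open>Rational approximation\<close>

text \<open>Two obstacles shape the proof. The closure of \<Omega> may be unbounded, and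
  approximation near a compact piece must still keep the poles off all of it. So the pieces are cut
  out by discs: a Cauchy kernel whose pole lies in \<open>closure \<Omega>\<close> but outside the
  disc is a uniform limit of polynomials on the disc, and every other kernel may stay as it is. The
  approximation is carried out on a union of discs around the piece, so that Cauchy's estimates
  control the derivatives at boundary points of \<Omega> as well.

  The other obstacle is membership in \<open>pade_D p q\<close>. Let \<open>f = N / D\<close>. If
  \<open>degree N < p\<close> and \<open>degree D < q\<close>, then \<open>D * f = N\<close> has
  zero coefficients at \<open>p, ..., p + q - 1\<close>, so \<open>D\<close> yields a kernel vector
  of the Hankel matrix and the determinant vanishes. Since \<open>F\<close> is arbitrary,
  \<open>q\<close> cannot be matched to \<open>degree D\<close>; hence it is the numerator that is
  raised to its maximal degree.\<close>

definition rational_approx :: "complex set \<Rightarrow> complex set \<Rightarrow> (complex \<Rightarrow> complex) \<Rightarrow> bool" where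
  "rational_approx W K g \<longleftrightarrow>
     (\<forall>e>0. \<exists>P Q. (\<forall>z. poly Q z = 0 \<longrightarrow> z \<in> W) \<and> (\<forall>z\<in>K. cmod (g z - poly P z / poly Q z) < e))"

lemma rational_approxD:
  assumes "rational_approx W K g" "e > 0"
  obtains P Q where "\<And>z. poly Q z = 0 \<Longrightarrow> z \<in> W" "\<And>z. z \<in> K \<Longrightarrow> cmod (g z - poly P z / poly Q z) < e"
  using assms unfolding rational_approx_def by meson

lemma rational_approx_rational:
  assumes "\<And>z. poly Q z = 0 \<Longrightarrow> z \<in> W" "\<And>z. z \<in> K \<Longrightarrow> g z = poly P z / poly Q z"
  shows "rational_approx W K g"
  unfolding rational_approx_def
proof (intro allI impI exI conjI ballI)
  fix e :: real and z assume "e > 0" "z \<in> K"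
  then show "cmod (g z - poly P z / poly Q z) < e"
    using assms(2) by simp
qed (use assms(1) in auto)

text \<open>Serves twice: for Riemann sums of Cauchy integrals and for partial sums of the geometric
  series.\<close>

lemma rational_approx_limit:
  assumes "\<And>e. e > 0 \<Longrightarrow> \<exists>h. rational_approx W K h \<and> (\<forall>z\<in>K. cmod (g z - h z) \<le> e)"
  shows "rational_approx W K g"
  unfolding rational_approx_def
proof (intro allI impI)
  fix e :: real assume "e > 0"
  then obtain h where h: "rational_approx W K h" "\<And>z. z \<in> K \<Longrightarrow> cmod (g z - h z) \<le> e / 2"
    using assms[of "e / 2"] by auto
  obtain P Q where PQ: "\<And>z. poly Q z = 0 \<Longrightarrow> z \<in> W" "\<And>z. z \<in> K \<Longrightarrow> cmod (h z - poly P z / poly Q z) < e / 2"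
    by (rule rational_approxD[OF h(1), of "e / 2"]) (use \<open>e > 0\<close> in \<open>simp, blast\<close>)
  have "cmod (g z - poly P z / poly Q z) < e" if "z \<in> K" for z
    using norm_diff_triangle_le[OF h(2)[OF that] order_refl, of "poly P z / poly Q z"] PQ(2)[OF that]
    by simp
  then show "\<exists>P Q. (\<forall>z. poly Q z = 0 \<longrightarrow> z \<in> W) \<and> (\<forall>z\<in>K. cmod (g z - poly P z / poly Q z) < e)"
    using PQ(1) by blast
qed

lemma rational_approx_const: "rational_approx W K (\<lambda>z. c)"
  by (rule rational_approx_rational[of 1 _ _ _ "[:c:]"]) auto

text \<open>Disjointness of \<open>W\<close> and \<open>K\<close> keeps both denominators nonzero on
  \<open>K\<close>; at a root, HOL's division by zero would spoil the passage to a common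
  denominator.\<close>

lemma rational_approx_add:
  assumes "W \<inter> K = {}" "rational_approx W K g" "rational_approx W K h"
  shows "rational_approx W K (\<lambda>z. g z + h z)"
  unfolding rational_approx_def
proof (intro allI impI)
  fix e :: real assume "e > 0"
  then have e2: "e / 2 > 0"
    by simp
  obtain P Q where PQ: "\<And>z. poly Q z = 0 \<Longrightarrow> z \<in> W" "\<And>z. z \<in> K \<Longrightarrow> cmod (g z - poly P z / poly Q z) < e / 2"
    by (rule rational_approxD[OF assms(2) e2]) blast
  obtain R S where RS: "\<And>z. poly S z = 0 \<Longrightarrow> z \<in> W" "\<And>z. z \<in> K \<Longrightarrow> cmod (h z - poly R z / poly S z) < e / 2"
    by (rule rational_approxD[OF assms(3) e2]) blast
  have "cmod (g z + h z - poly (P * S + R * Q) z / poly (Q * S) z) < e" if z: "z \<in> K" for z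
  proof -
    have nz: "poly Q z \<noteq> 0" "poly S z \<noteq> 0"
      using PQ(1) RS(1) assms(1) z by blast+
    have "g z + h z - poly (P * S + R * Q) z / poly (Q * S) z
        = (g z - poly P z / poly Q z) + (h z - poly R z / poly S z)"
      using nz by (simp add: field_simps)
    then show ?thesis
      using norm_triangle_lt[of "g z - poly P z / poly Q z" "h z - poly R z / poly S z" e]
        PQ(2)[OF z] RS(2)[OF z] by (simp only:)
  qed
  moreover have "\<forall>z. poly (Q * S) z = 0 \<longrightarrow> z \<in> W"
    using PQ(1) RS(1) by auto
  ultimately show "\<exists>P Q. (\<forall>z. poly Q z = 0 \<longrightarrow> z \<in> W) \<and> (\<forall>z\<in>K. cmod (g z + h z - poly P z / poly Q z) < e)"
    by blast
qed

lemma rational_approx_cmult: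
  assumes "rational_approx W K g"
  shows "rational_approx W K (\<lambda>z. c * g z)"
  unfolding rational_approx_def
proof (intro allI impI)
  fix e :: real assume "e > 0"
  then have e: "e / (cmod c + 1) > 0"
    by (simp add: add_nonneg_pos)
  obtain P Q where PQ: "\<And>z. poly Q z = 0 \<Longrightarrow> z \<in> W"
    "\<And>z. z \<in> K \<Longrightarrow> cmod (g z - poly P z / poly Q z) < e / (cmod c + 1)"
    by (rule rational_approxD[OF assms e]) blast
  have "cmod (c * g z - poly (Polynomial.smult c P) z / poly Q z) < e" if z: "z \<in> K" for z
  proof -
    have "c * g z - poly (Polynomial.smult c P) z / poly Q z = c * (g z - poly P z / poly Q z)"
      by (simp add: algebra_simps)
    then have "cmod (c * g z - poly (Polynomial.smult c P) z / poly Q z) \<le> cmod c * (e / (cmod c + 1))"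
      using mult_left_mono[OF less_imp_le[OF PQ(2)[OF z]], of "cmod c"] by (simp only: norm_mult) simp
    also have "\<dots> < e"
      using \<open>e > 0\<close> by (simp add: add_nonneg_pos pos_divide_less_eq distrib_left)
    finally show ?thesis .
  qed
  then show "\<exists>P Q. (\<forall>z. poly Q z = 0 \<longrightarrow> z \<in> W) \<and> (\<forall>z\<in>K. cmod (c * g z - poly P z / poly Q z) < e)"
    using PQ(1) by blast
qed

lemma rational_approx_diff:
  assumes "W \<inter> K = {}" "rational_approx W K g" "rational_approx W K h"
  shows "rational_approx W K (\<lambda>z. g z - h z)"
  using rational_approx_add[OF assms(1,2) rational_approx_cmult[OF assms(3), of "-1"]] by simp

lemma rational_approx_sum:
  assumes "W \<inter> K = {}" "\<And>i. i \<in> I \<Longrightarrow> rational_approx W K (g i)"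
  shows "rational_approx W K (\<lambda>z. \<Sum>i\<in>I. g i z)"
  using assms(2)
proof (induction I rule: infinite_finite_induct)
  case (insert i I)
  then show ?case
    using rational_approx_add[OF assms(1), of "g i" "\<lambda>z. \<Sum>i\<in>I. g i z"] by simp
qed (simp_all add: rational_approx_const)

section \<open>Cauchy integrals over segments, squares and grids\<close>

text \<open>Riemann sums: on a short piece from \<open>x\<close> to \<open>y\<close> the integrand
  is frozen at \<open>x\<close>, which leaves a multiple of the kernel \<open>1 / (x - z)\<close>.
  Uniform continuity on the product of the segment with \<open>K\<close> makes the error uniform in
  \<open>z\<close>.\<close>

lemma rational_approx_cauchy_segment:
  assumes "compact K" "continuous_on (closed_segment a b) f" "closed_segment a b \<inter> K = {}"
    and kernel: "\<And>w. w \<notin> K \<Longrightarrow> rational_approx W K (\<lambda>z. 1 / (w - z))" and "W \<inter> K = {}"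
  shows "rational_approx W K (\<lambda>z. contour_integral (linepath a b) (\<lambda>w. f w / (w - z)))"
proof (rule rational_approx_limit)
  fix e :: real assume "e > 0"
  \<comment> \<open>The admissible error per unit length; \<open>+ 1\<close> keeps the divisor
    positive when \<open>a = b\<close>.\<close>
  define e' where "e' = e / (cmod (b - a) + 1)"
  have e': "e' > 0" "e' * cmod (b - a) \<le> e"
    using \<open>e > 0\<close> unfolding e'_def
    by (simp_all add: add_nonneg_pos pos_divide_le_eq distrib_left)
  have cont: "continuous_on (closed_segment a b) (\<lambda>w. f w / (w - z))" if "z \<in> K" for z
    using assms(2,3) that by (auto intro!: continuous_intros)
  have "uniformly_continuous_on (closed_segment a b \<times> K) (\<lambda>p. f (fst p) / (fst p - snd p))"
  proof (rule compact_uniformly_continuous)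
    have "continuous_on (closed_segment a b \<times> K) (\<lambda>p. f (fst p))"
      by (rule continuous_on_compose2[OF assms(2) continuous_on_fst[OF continuous_on_id]]) auto
    then show "continuous_on (closed_segment a b \<times> K) (\<lambda>p. f (fst p) / (fst p - snd p))"
      using assms(3) by (auto intro!: continuous_intros)
  qed (use assms(1) in \<open>auto intro: compact_Times\<close>)
  then obtain d where d: "d > 0"
    "\<And>p p'. p \<in> closed_segment a b \<times> K \<Longrightarrow> p' \<in> closed_segment a b \<times> K \<Longrightarrow> dist p' p < d \<Longrightarrow>
       dist (f (fst p') / (fst p' - snd p')) (f (fst p) / (fst p - snd p)) < e'"
    using \<open>e' > 0\<close> unfolding uniformly_continuous_on_def by metis
  have d': "cmod (f w / (w - z) - f x / (x - z)) \<le> e'"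
    if "w \<in> closed_segment a b" "x \<in> closed_segment a b" "z \<in> K" "cmod (w - x) < d" for w x z
    using d(2)[of "(x, z)" "(w, z)"] that by (auto simp: dist_Pair_Pair dist_norm intro: less_imp_le)
  \<comment> \<open>Induction on the number of bisections still to be made. The bound is
    proportional to the length of the piece, so the bounds of the two halves add up to exactly the
    bound of the whole.\<close>
  have "\<exists>h. rational_approx W K h \<and>
      (\<forall>z\<in>K. cmod (contour_integral (linepath x y) (\<lambda>w. f w / (w - z)) - h z) \<le> e' * cmod (y - x))"
    if "closed_segment x y \<subseteq> closed_segment a b" "cmod (y - x) < 2 ^ n * d" for n x y
    using that
  proof (induction n arbitrary: x y)
    case 0
    have x: "x \<in> closed_segment a b"
      using 0 by auto
    have "cmod (contour_integral (linepath x y) (\<lambda>w. f w / (w - z)) - f x * (y - x) * (1 / (x - z)))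
        \<le> e' * cmod (y - x)" if z: "z \<in> K" for z
    proof (rule has_contour_integral_bound_linepath)
      have "(\<lambda>w. f w / (w - z)) contour_integrable_on linepath x y"
        by (rule contour_integrable_continuous_linepath[OF continuous_on_subset[OF cont[OF z] 0(1)]])
      from has_contour_integral_diff[OF has_contour_integral_integral[OF this]
          has_contour_integral_const_linepath[of "f x / (x - z)" y x]]
      show "((\<lambda>w. f w / (w - z) - f x / (x - z)) has_contour_integral
          contour_integral (linepath x y) (\<lambda>w. f w / (w - z)) - f x * (y - x) * (1 / (x - z))) (linepath x y)"
        by simp
    next
      fix w assume w: "w \<in> closed_segment x y"
      have "cmod (w - x) < d"
        using segment_bound(1)[OF w] 0(2) by simp
      then show "cmod (f w / (w - z) - f x / (x - z)) \<le> e'"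
        using d'[of w x z] w x z 0(1) by auto
    qed (use e' in simp)
    moreover have "rational_approx W K (\<lambda>z. f x * (y - x) * (1 / (x - z)))"
      using x assms(3) by (intro rational_approx_cmult kernel) auto
    ultimately show ?case
      by blast
  next
    case (Suc n)
    define m where "m = midpoint x y"
    have sub: "closed_segment x m \<subseteq> closed_segment x y" "closed_segment m y \<subseteq> closed_segment x y"
      unfolding m_def by (auto simp: subset_closed_segment)
    have half: "cmod (m - x) = cmod (y - x) / 2" "cmod (y - m) = cmod (y - x) / 2"
      using dist_midpoint(2)[of x y] dist_midpoint(3)[of x y] dist_midpoint(1)[of x y] dist_midpoint(4)[of x y]
      unfolding m_def dist_norm by (simp_all add: norm_minus_commute)
    have small: "cmod (m - x) < 2 ^ n * d" "cmod (y - m) < 2 ^ n * d"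
      unfolding half using Suc.prems(2) by simp_all
    obtain g where g: "rational_approx W K g"
      "\<And>z. z \<in> K \<Longrightarrow> cmod (contour_integral (linepath x m) (\<lambda>w. f w / (w - z)) - g z) \<le> e' * cmod (m - x)"
      using Suc.IH[OF order_trans[OF sub(1) Suc.prems(1)] small(1)] by blast
    obtain h where h: "rational_approx W K h"
      "\<And>z. z \<in> K \<Longrightarrow> cmod (contour_integral (linepath m y) (\<lambda>w. f w / (w - z)) - h z) \<le> e' * cmod (y - m)"
      using Suc.IH[OF order_trans[OF sub(2) Suc.prems(1)] small(2)] by blast
    have "cmod (contour_integral (linepath x y) (\<lambda>w. f w / (w - z)) - (g z + h z)) \<le> e' * cmod (y - x)"
      if z: "z \<in> K" for z
    proof -
      have "contour_integral (linepath x y) (\<lambda>w. f w / (w - z)) =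
          contour_integral (linepath x m) (\<lambda>w. f w / (w - z)) + contour_integral (linepath m y) (\<lambda>w. f w / (w - z))"
        unfolding m_def
        by (rule contour_integral_midpoint[OF continuous_on_subset[OF cont[OF z] Suc.prems(1)]])
      then show ?thesis
        using norm_diff_triangle_ineq[of "contour_integral (linepath x m) (\<lambda>w. f w / (w - z))"
            "contour_integral (linepath m y) (\<lambda>w. f w / (w - z))" "g z" "h z"] g(2)[OF z] h(2)[OF z] half
        by simp
    qed
    then show ?case
      using rational_approx_add[OF assms(5) g(1) h(1)] by blast
  qed
  moreover obtain n where "cmod (b - a) / d < 2 ^ n"
    using real_arch_pow[of 2 "cmod (b - a) / d"] by auto
  then have "cmod (b - a) < 2 ^ n * d"
    using d(1) by (simp add: field_simps)
  ultimately obtain h where "rational_approx W K h"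
    "\<forall>z\<in>K. cmod (contour_integral (linepath a b) (\<lambda>w. f w / (w - z)) - h z) \<le> e' * cmod (b - a)"
    by (meson order_refl)
  then show "\<exists>h. rational_approx W K h \<and>
      (\<forall>z\<in>K. cmod (contour_integral (linepath a b) (\<lambda>w. f w / (w - z)) - h z) \<le> e)"
    using e'(2) by (meson order_trans)
qed

text \<open>Opposite sides are run through in the same direction, to the right or upwards, and
  signed. In a grid, the top side of one square and the bottom side of the next then become
  literally the same term.\<close>

lemma contour_integral_rectpath:
  assumes "continuous_on (path_image (rectpath a c)) h"
  shows "contour_integral (rectpath a c) h =
    contour_integral (linepath a (Complex (Re c) (Im a))) h +
    contour_integral (linepath (Complex (Re c) (Im a)) c) h -
    contour_integral (linepath (Complex (Re a) (Im c)) c) h -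
    contour_integral (linepath a (Complex (Re a) (Im c))) h"
proof -
  define b d where "b = Complex (Re c) (Im a)" and "d = Complex (Re a) (Im c)"
  have r: "rectpath a c = linepath a b +++ linepath b c +++ linepath c d +++ linepath d a"
    unfolding rectpath_def b_def d_def by (simp add: Let_def)
  have "path_image (rectpath a c) =
      closed_segment a b \<union> (closed_segment b c \<union> (closed_segment c d \<union> closed_segment d a))"
    unfolding r by (simp add: path_image_join)
  then have cont: "continuous_on (closed_segment a b) h" "continuous_on (closed_segment b c) h"
    "continuous_on (closed_segment c d) h" "continuous_on (closed_segment d a) h"
    using assms by (auto elim: continuous_on_subset)
  note int = this[THEN contour_integrable_continuous_linepath]
  have "contour_integral (rectpath a c) h = contour_integral (linepath a b) h +
      (contour_integral (linepath b c) h + (contour_integral (linepath c d) h + contour_integral (linepath d a) h))"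
    unfolding r using int by (simp add: contour_integrable_join valid_path_join)
  then show ?thesis
    using contour_integral_reverse_linepath[OF cont(3)] contour_integral_reverse_linepath[OF cont(4)]
    unfolding b_def[symmetric] d_def[symmetric] by simp
qed


text \<open>Inside the square the winding number is 1; off the closed square the integrand is
  holomorphic on it. Points \<open>z\<close> on the boundary are excluded, which later forces a
  limit argument for points on grid lines.\<close>

lemma square_cauchy:
  fixes c :: complex and d :: real
  defines "corner \<equiv> \<lambda>x y. c + Complex (d * x) (d * y)"
  assumes "d > 0" "f holomorphic_on cbox (corner 0 0) (corner 1 1)"
    and z: "z \<in> box (corner 0 0) (corner 1 1) \<or> z \<notin> cbox (corner 0 0) (corner 1 1)"
  shows "contour_integral (linepath (corner 0 0) (corner 1 0)) (\<lambda>w. f w / (w - z)) +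
    contour_integral (linepath (corner 1 0) (corner 1 1)) (\<lambda>w. f w / (w - z)) -
    contour_integral (linepath (corner 0 1) (corner 1 1)) (\<lambda>w. f w / (w - z)) -
    contour_integral (linepath (corner 0 0) (corner 0 1)) (\<lambda>w. f w / (w - z)) =
    (if z \<in> box (corner 0 0) (corner 1 1) then 2 * pi * \<i> * f z else 0)" (is "?lhs = ?rhs")
proof -
  define h where "h = (\<lambda>w. f w / (w - z))"
  define R where "R = rectpath (corner 0 0) (corner 1 1)"
  have le: "Re (corner 0 0) \<le> Re (corner 1 1)" "Im (corner 0 0) \<le> Im (corner 1 1)"
    using assms(2) unfolding corner_def by auto
  have sub: "path_image R \<subseteq> cbox (corner 0 0) (corner 1 1)" and nz: "z \<notin> path_image R"
    using path_image_rectpath_subset_cbox[OF le] path_image_rectpath_inter_box[OF le] z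
    unfolding R_def by auto
  have "continuous_on (path_image R) f"
    using sub assms(3) holomorphic_on_imp_continuous_on continuous_on_subset by blast
  then have "continuous_on (path_image R) h"
    unfolding h_def using nz by (auto intro!: continuous_intros)
  moreover have "Complex (Re (corner 1 1)) (Im (corner 0 0)) = corner 1 0"
    "Complex (Re (corner 0 0)) (Im (corner 1 1)) = corner 0 1"
    unfolding corner_def by (simp_all add: complex_eq_iff)
  ultimately have "?lhs = contour_integral R h"
    using contour_integral_rectpath[of "corner 0 0" "corner 1 1" h] unfolding R_def h_def[symmetric]
    by (simp only:)
  also have "\<dots> = ?rhs"
  proof (cases "z \<in> box (corner 0 0) (corner 1 1)")
    case True
    have "(h has_contour_integral complex_of_real (2 * pi) * \<i> * winding_number R z * f z) R"
      unfolding h_def using True sub nz assms(3)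
      by (intro Cauchy_integral_formula_convex_simple[of "cbox (corner 0 0) (corner 1 1)"])
        (auto simp: R_def interior_cbox)
    moreover have "winding_number R z = 1"
      unfolding R_def by (rule winding_number_rectpath[OF True])
    ultimately show ?thesis
      using True by (auto dest!: contour_integral_unique)
  next
    case False
    then have "z \<notin> cbox (corner 0 0) (corner 1 1)"
      using z by blast
    then have "h holomorphic_on cbox (corner 0 0) (corner 1 1)"
      unfolding h_def by (intro holomorphic_intros assms(3)) auto
    then have "(h has_contour_integral 0) R"
      using sub by (intro Cauchy_theorem_convex_simple[of _ "cbox (corner 0 0) (corner 1 1)"]) (auto simp: R_def)
    then show ?thesis
      using False by (auto dest!: contour_integral_unique)
  qed
  finally show ?thesis .
qed

text \<open>Applied to real and imaginary parts in \<open>grid_cauchy\<close>: a point of an open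
  square lies in no other closed square, so only one square contributes to the sum of boundary
  integrals.\<close>

lemma grid_index_unique:
  fixes x d :: real and i j :: int
  assumes "d * of_int i < x" "x < d * (of_int i + 1)" "d * of_int j \<le> x" "x \<le> d * (of_int j + 1)" "d > 0"
  shows "i = j"
proof -
  have "d * of_int i < d * (of_int j + 1)" "d * of_int j < d * (of_int i + 1)"
    using assms by linarith+
  then have "of_int i < (of_int j + 1 :: real)" "of_int j < (of_int i + 1 :: real)"
    using assms(5) by (simp_all only: mult_less_cancel_left_pos)
  then show ?thesis
    by linarith
qed

text \<open>The combinatorial form of edge cancellation: \<open>g x\<close> is the bottom (left)
  edge of square \<open>x\<close>, and \<open>g (s x)\<close> its top (right) edge, seen as an edge
  of the neighbouring square \<open>s x\<close>.\<close>

lemma sum_shift_diff: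
  fixes g :: "'a \<Rightarrow> 'b :: ab_group_add"
  assumes "finite S" "inj_on s S"
  shows "(\<Sum>x\<in>S. g x) - (\<Sum>x\<in>S. g (s x)) = (\<Sum>x\<in>S - s ` S. g x) - (\<Sum>x\<in>s ` S - S. g x)"
proof -
  have "(\<Sum>x\<in>S. g (s x)) = sum g (s ` S)"
    using assms(2) by (simp add: sum.reindex)
  moreover have "sum g S = sum g (S \<inter> s ` S) + sum g (S - s ` S)"
    "sum g (s ` S) = sum g (S \<inter> s ` S) + sum g (s ` S - S)"
    using assms(1) sum.Int_Diff[of S g "s ` S"] sum.Int_Diff[of "s ` S" g S] by (simp_all add: Int_commute)
  ultimately show ?thesis
    by simp
qed

text \<open>
  The boundaries of finitely many squares of a grid: an edge lying in two of the squares is traversed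
  twice in opposite directions, and what remains are the edges of exactly one of the squares.
\<close>

lemma grid_cauchy:
  fixes d :: real and S :: "(int \<times> int) set" and f :: "complex \<Rightarrow> complex"
  defines "pt \<equiv> \<lambda>x y :: int. Complex (d * of_int x) (d * of_int y)"
  defines "sq \<equiv> \<lambda>(x, y). cbox (pt x y) (pt (x + 1) (y + 1))"
  defines "hor \<equiv> \<lambda>z (x, y). contour_integral (linepath (pt x y) (pt (x + 1) y)) (\<lambda>w. f w / (w - z))"
  defines "ver \<equiv> \<lambda>z (x, y). contour_integral (linepath (pt x y) (pt x (y + 1))) (\<lambda>w. f w / (w - z))"
  defines "up \<equiv> \<lambda>(x, y). (x, y + 1)"
  defines "right \<equiv> \<lambda>(x, y). (x + 1, y)"
  assumes "d > 0" "finite S" "\<And>s. s \<in> S \<Longrightarrow> f holomorphic_on sq s"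
    and "(a, b) \<in> S" and z: "z \<in> box (pt a b) (pt (a + 1) (b + 1))"
  shows "2 * pi * \<i> * f z = (\<Sum>s\<in>S - up ` S. hor z s) - (\<Sum>s\<in>up ` S - S. hor z s)
    + (\<Sum>s\<in>right ` S - S. ver z s) - (\<Sum>s\<in>S - right ` S. ver z s)"
proof -
  \<comment> \<open>\<open>hor z (up s)\<close> is the top edge and \<open>ver z (right s)\<close>
    the right edge of the square \<open>s\<close>.\<close>
  have one: "hor z s + ver z (right s) - hor z (up s) - ver z s = (if s = (a, b) then 2 * pi * \<i> * f z else 0)"
    if "s \<in> S" for s
  proof -
    obtain x y where s: "s = (x, y)"
      by force
    define corner where "corner = (\<lambda>u v. pt x y + Complex (d * u) (d * v))"
    have corner_app: "pt x y + Complex (d * u) (d * v) = corner u v" for u v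
      unfolding corner_def ..
    have corner: "corner 0 0 = pt x y" "corner 1 0 = pt (x + 1) y" "corner 0 1 = pt x (y + 1)"
      "corner 1 1 = pt (x + 1) (y + 1)"
      unfolding corner_def pt_def by (simp_all add: complex_eq_iff algebra_simps)
    have "s = (a, b) \<longleftrightarrow> z \<in> box (corner 0 0) (corner 1 1)" and
      "s = (a, b) \<or> z \<notin> cbox (corner 0 0) (corner 1 1)"
    proof -
      have "s = (a, b)" if "z \<in> cbox (corner 0 0) (corner 1 1)"
        using that z assms(7) grid_index_unique[of d a "Re z" x] grid_index_unique[of d b "Im z" y]
        unfolding corner s by (simp add: pt_def in_box_complex_iff in_cbox_complex_iff)
      then show "s = (a, b) \<longleftrightarrow> z \<in> box (corner 0 0) (corner 1 1)"
        "s = (a, b) \<or> z \<notin> cbox (corner 0 0) (corner 1 1)"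
        using z box_subset_cbox unfolding corner s by auto
    qed
    moreover have "f holomorphic_on cbox (corner 0 0) (corner 1 1)"
      using assms(9)[OF that] unfolding s sq_def corner by simp
    ultimately show ?thesis
      using square_cauchy[OF assms(7), of f "pt x y" z] unfolding corner_app corner
      by (simp add: s hor_def ver_def up_def right_def)
  qed
  have "2 * pi * \<i> * f z = (\<Sum>s\<in>S. hor z s + ver z (right s) - hor z (up s) - ver z s)"
    using assms(8,10) by (simp add: one)
  also have "\<dots> = ((\<Sum>s\<in>S. hor z s) - (\<Sum>s\<in>S. hor z (up s))) - ((\<Sum>s\<in>S. ver z s) - (\<Sum>s\<in>S. ver z (right s)))"
    by (simp add: sum.distrib sum_subtractf)
  also have "\<dots> = ((\<Sum>s\<in>S - up ` S. hor z s) - (\<Sum>s\<in>up ` S - S. hor z s))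
    - ((\<Sum>s\<in>S - right ` S. ver z s) - (\<Sum>s\<in>right ` S - S. ver z s))"
    using assms(8) by (subst (1 2) sum_shift_diff) (auto simp: inj_on_def up_def right_def)
  finally show ?thesis
    by simp
qed

section \<open>Runge's theorem\<close>

text \<open>Placing the poles is left to the caller through \<open>kernel\<close>, since a grid edge
  off \<open>K\<close> may still run through points where no pole is allowed. The conclusion is
  restricted to \<open>interior K\<close> because a point on a grid line is reached as a limit of
  points of \<open>K\<close> lying in open squares.\<close>

theorem runge_interior:
  assumes K: "compact K" and U: "open U" "K \<subseteq> U" "f holomorphic_on U" and W: "W \<inter> K = {}"
    and kernel: "\<And>w. w \<notin> K \<Longrightarrow> rational_approx W K (\<lambda>z. 1 / (w - z))"
  shows "rational_approx W (interior K) f"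
proof -
  obtain r where r: "r > 0" "(\<Union>x\<in>K. cball x r) \<subseteq> U"
    by (rule compact_subset_open_imp_cball_epsilon_subset[OF K U(1,2)]) blast
  \<comment> \<open>Two points of one square differ by at most \<open>d\<close> in each coordinate,
    hence by at most \<open>2 * d = r\<close>; so every square meeting \<open>K\<close> lies in
    \<open>U\<close>.\<close>
  define d where "d = r / 2"
  have d: "d > 0"
    unfolding d_def using r by simp
  define pt where "pt = (\<lambda>x y :: int. Complex (d * of_int x) (d * of_int y))"
  define sq where "sq = (\<lambda>(x, y). cbox (pt x y) (pt (x + 1) (y + 1)))"
  define hor where "hor = (\<lambda>z (x, y). contour_integral (linepath (pt x y) (pt (x + 1) y)) (\<lambda>w. f w / (w - z)))"
  define ver where "ver = (\<lambda>z (x, y). contour_integral (linepath (pt x y) (pt x (y + 1))) (\<lambda>w. f w / (w - z)))"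
  define up where "up = (\<lambda>(x :: int, y :: int). (x, y + 1))"
  define right where "right = (\<lambda>(x :: int, y :: int). (x + 1, y))"
  note defs = pt_def sq_def hor_def ver_def up_def right_def
  define S where "S = {s. sq s \<inter> K \<noteq> {}}"
  have sqU: "sq s \<subseteq> U" if sS: "s \<in> S" for s
  proof
    fix w assume w: "w \<in> sq s"
    obtain k where k: "k \<in> sq s" "k \<in> K"
      using sS unfolding S_def by blast
    obtain x y where s: "s = (x, y)"
      by force
    have "\<bar>Re (k - w)\<bar> \<le> d" "\<bar>Im (k - w)\<bar> \<le> d"
      using w k(1) unfolding s sq_def pt_def by (auto simp: in_cbox_complex_iff algebra_simps)
    then have "cmod (k - w) \<le> r"
      using cmod_le[of "k - w"] unfolding d_def by linarith
    then have "w \<in> cball k r"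
      by (simp add: dist_norm)
    then show "w \<in> U"
      using r(2) k(2) by blast
  qed
  have "finite S"
  proof -
    obtain B where B: "\<And>z. z \<in> K \<Longrightarrow> cmod z \<le> B"
      using compact_imp_bounded[OF K] by (auto simp: bounded_iff)
    have bd: "i \<in> {\<lfloor>- B / d\<rfloor> - 1..\<lceil>B / d\<rceil>}" if "d * of_int i \<le> t" "t \<le> d * (of_int i + 1)" "\<bar>t\<bar> \<le> B"
      for i :: int and t :: real
    proof -
      have "of_int i * d \<le> B" "- B \<le> (of_int i + 1) * d"
        using that by (simp_all add: mult.commute)
      then have "of_int i \<le> B / d" "- B / d \<le> of_int i + 1"
        using d by (simp_all only: pos_le_divide_eq pos_divide_le_eq)
      then show ?thesis
        unfolding atLeastAtMost_iff by linarith
    qed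
    have "S \<subseteq> {\<lfloor>- B / d\<rfloor> - 1..\<lceil>B / d\<rceil>} \<times> {\<lfloor>- B / d\<rfloor> - 1..\<lceil>B / d\<rceil>}"
    proof
      fix s assume "s \<in> S"
      then obtain k where k: "k \<in> sq s" "k \<in> K"
        unfolding S_def by blast
      obtain x y where s: "s = (x, y)"
        by force
      show "s \<in> {\<lfloor>- B / d\<rfloor> - 1..\<lceil>B / d\<rceil>} \<times> {\<lfloor>- B / d\<rfloor> - 1..\<lceil>B / d\<rceil>}"
        using k(1) B[OF k(2)] abs_Re_le_cmod[of k] abs_Im_le_cmod[of k] bd[of x "Re k"] bd[of y "Im k"]
        unfolding s sq_def pt_def by (auto simp: in_cbox_complex_iff)
    qed
    then show ?thesis
      by (rule finite_subset) simp
  qed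
  \<comment> \<open>A surviving edge belongs to a square \<open>s\<close> meeting \<open>K\<close>,
    so \<open>f\<close> is continuous on it, and to a square \<open>t\<close> not meeting
    \<open>K\<close>, so the edge misses \<open>K\<close>.\<close>
  have edge: "rational_approx W K (\<lambda>z. contour_integral (linepath a b) (\<lambda>w. f w / (w - z)))"
    if "closed_segment a b \<subseteq> sq s" "closed_segment a b \<subseteq> sq t" "s \<in> S" "t \<notin> S" for a b s t
  proof (rule rational_approx_cauchy_segment[OF K _ _ kernel W])
    show "continuous_on (closed_segment a b) f"
      using that sqU[of s] U(3) by (meson continuous_on_subset holomorphic_on_imp_continuous_on)
    show "closed_segment a b \<inter> K = {}"
      using that unfolding S_def by auto
  qed
  have seg: "closed_segment (pt x y) (pt (x + 1) y) \<subseteq> sq (x, y)"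
    "closed_segment (pt x y) (pt (x + 1) y) \<subseteq> sq (x, y - 1)"
    "closed_segment (pt x y) (pt x (y + 1)) \<subseteq> sq (x, y)"
    "closed_segment (pt x y) (pt x (y + 1)) \<subseteq> sq (x - 1, y)" for x y
    using d unfolding sq_def prod.case
    by (intro closed_segment_subset convex_box; simp add: pt_def in_cbox_complex_iff)+
  have im: "(x, y) \<in> up ` S \<longleftrightarrow> (x, y - 1) \<in> S" "(x, y) \<in> right ` S \<longleftrightarrow> (x - 1, y) \<in> S" for x y
    unfolding up_def right_def by (auto simp: image_iff split: prod.splits intro!: bexI)
  define g where "g = (\<lambda>z. 1 / (2 * pi * \<i>) * ((\<Sum>s\<in>S - up ` S. hor z s) - (\<Sum>s\<in>up ` S - S. hor z s)
    + (\<Sum>s\<in>right ` S - S. ver z s) - (\<Sum>s\<in>S - right ` S. ver z s)))"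
  have "rational_approx W K (\<lambda>z. hor z s)" if "s \<in> S - up ` S \<or> s \<in> up ` S - S" for s
    using that im(1) edge[OF seg(1,2)] edge[OF seg(2,1)] by (cases s) (auto simp: hor_def)
  moreover have "rational_approx W K (\<lambda>z. ver z s)" if "s \<in> S - right ` S \<or> s \<in> right ` S - S" for s
    using that im(2) edge[OF seg(3,4)] edge[OF seg(4,3)] by (cases s) (auto simp: ver_def)
  ultimately have g: "rational_approx W K g"
    unfolding g_def using W
    by (intro rational_approx_cmult rational_approx_diff rational_approx_add rational_approx_sum) auto
  have fg: "f z = g z" if z: "z \<in> K" "z \<in> box (pt a b) (pt (a + 1) (b + 1))" for z a b
  proof -
    have "(a, b) \<in> S"
      using z box_subset_cbox unfolding S_def sq_def by auto
    then have "2 * pi * \<i> * f z = (\<Sum>s\<in>S - up ` S. hor z s) - (\<Sum>s\<in>up ` S - S. hor z s)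
        + (\<Sum>s\<in>right ` S - S. ver z s) - (\<Sum>s\<in>S - right ` S. ver z s)"
      using grid_cauchy[where d = d and S = S and f = f and a = a and b = b and z = z]
        d \<open>finite S\<close> z(2) sqU holomorphic_on_subset[OF U(3)] unfolding defs by auto
    then show ?thesis
      unfolding g_def by (simp add: field_simps)
  qed
  show ?thesis
    unfolding rational_approx_def
  proof (intro allI impI)
    fix e :: real assume "e > 0"
    then have e2: "e / 2 > 0"
      by simp
    obtain P Q where PQ: "\<And>z. poly Q z = 0 \<Longrightarrow> z \<in> W" "\<And>z. z \<in> K \<Longrightarrow> cmod (g z - poly P z / poly Q z) < e / 2"
      by (rule rational_approxD[OF g e2]) blast
    have "cmod (f z - poly P z / poly Q z) < e" if z: "z \<in> interior K" for z
    proof -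
      define a b where "a = \<lfloor>Re z / d\<rfloor>" and "b = \<lfloor>Im z / d\<rfloor>"
      have ab: "d * of_int a \<le> Re z" "Re z < d * (of_int a + 1)" "d * of_int b \<le> Im z" "Im z < d * (of_int b + 1)"
        using floor_divide_lower[OF d] floor_divide_upper[OF d] unfolding a_def b_def
        by (simp_all add: mult.commute)
      \<comment> \<open>The floors put \<open>z\<close> in a half-open square, closed at the left
        and below. Moving diagonally right and up enters the open square, where \<open>f = g\<close>
        is known. The limit is taken of \<open>f - P / Q\<close>, whose continuity at
        \<open>z\<close> is clear, rather than of \<open>g\<close>.\<close>
      define u where "u = (\<lambda>t :: real. z + of_real t * Complex 1 1)"
      have "(u \<longlongrightarrow> z + of_real 0 * Complex 1 1) (at_right 0)"
        unfolding u_def by (intro tendsto_intros)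
      then have u: "(u \<longlongrightarrow> z) (at_right 0)"
        by simp
      have zK: "z \<in> K"
        using z interior_subset by blast
      have "isCont f z"
        using continuous_on_interior[OF holomorphic_on_imp_continuous_on[OF U(3)]] zK U(1,2)
        by (auto simp: interior_open)
      moreover have "poly Q z \<noteq> 0"
        using PQ(1) W zK by auto
      ultimately have "isCont (\<lambda>z. cmod (f z - poly P z / poly Q z)) z"
        by (intro continuous_intros) auto
      then have lim: "((\<lambda>t. cmod (f (u t) - poly P (u t) / poly Q (u t))) \<longlongrightarrow> cmod (f z - poly P z / poly Q z)) (at_right 0)"
        by (rule isCont_tendsto_compose[OF _ u])
      have "\<forall>\<^sub>F t in at_right 0. u t \<in> interior K"
        by (rule topological_tendstoD[OF u open_interior z])
      moreover have "\<forall>\<^sub>F t in at_right 0. t \<in> {0<..<min (d * (of_int a + 1) - Re z) (d * (of_int b + 1) - Im z)}"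
        using ab by (intro eventually_at_right_real) auto
      ultimately have "\<forall>\<^sub>F t in at_right 0. cmod (f (u t) - poly P (u t) / poly Q (u t)) \<le> e / 2"
      proof eventually_elim
        case (elim t)
        have "u t \<in> box (pt a b) (pt (a + 1) (b + 1))"
          using elim(2) ab unfolding u_def pt_def by (auto simp: in_box_complex_iff)
        moreover have "u t \<in> K"
          using elim(1) interior_subset by blast
        ultimately show ?case
          using fg PQ(2) less_imp_le by metis
      qed
      from tendsto_upperbound[OF lim this]
      show ?thesis
        using \<open>e > 0\<close> by simp
    qed
    then show "\<exists>P Q. (\<forall>z. poly Q z = 0 \<longrightarrow> z \<in> W) \<and> (\<forall>z\<in>interior K. cmod (f z - poly P z / poly Q z) < e)"
      using PQ(1) by blast
  qed
qed


section \<open>From compact to closed sets\<close>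

lemma rational_approx_mono:
  assumes "rational_approx W K g" "W \<subseteq> W'" "K' \<subseteq> K"
  shows "rational_approx W' K' g"
  using assms unfolding rational_approx_def by (meson subsetD)

text \<open>The geometric series in \<open>z / w\<close> converges uniformly on the disc, and its
  partial sums are polynomials, so \<open>W\<close> can be any set.\<close>

lemma rational_approx_cauchy_kernel:
  assumes "cmod w > \<rho>"
  shows "rational_approx W (cball 0 \<rho>) (\<lambda>z. 1 / (w - z))"
proof (cases "\<rho> < 0")
  case True
  then show ?thesis
    by (intro rational_approx_rational[of 1 _ _ _ 1]) auto
next
  case False
  then have w: "w \<noteq> 0"
    using assms by auto
  have "uniform_limit (cball 0 \<rho>) (\<lambda>n z. \<Sum>i<n. (1 / w) * (z / w) ^ i) (\<lambda>z. \<Sum>i. (1 / w) * (z / w) ^ i) sequentially"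
  proof (rule Weierstrass_m_test)
    show "cmod ((1 / w) * (z / w) ^ i) \<le> (1 / cmod w) * (\<rho> / cmod w) ^ i" if "z \<in> cball 0 \<rho>" for i z
      using that by (auto simp: norm_mult norm_divide norm_power intro!: divide_right_mono power_mono)
    show "summable (\<lambda>i. (1 / cmod w) * (\<rho> / cmod w) ^ i)"
      using False w assms by (intro summable_mult summable_geometric) simp
  qed
  moreover have "(\<Sum>i. (1 / w) * (z / w) ^ i) = 1 / (w - z)" if "z \<in> cball 0 \<rho>" for z
  proof -
    have zw: "cmod (z / w) < 1"
      using that assms w by (simp add: norm_divide)
    then have "w - z \<noteq> 0"
      using w by auto
    have "(\<lambda>i. (1 / w) * (z / w) ^ i) sums ((1 / w) * (1 / (1 - z / w)))"
      by (intro sums_mult geometric_sums zw)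
    also have "(1 / w) * (1 / (1 - z / w)) = 1 / (w - z)"
      using w \<open>w - z \<noteq> 0\<close> by (simp add: field_simps)
    finally show ?thesis
      by (rule sums_unique[symmetric])
  qed
  ultimately have lim: "uniform_limit (cball 0 \<rho>) (\<lambda>n z. \<Sum>i<n. (1 / w) * (z / w) ^ i) (\<lambda>z. 1 / (w - z)) sequentially"
    by (subst (asm) uniform_limit_cong'[OF refl]) auto
  show ?thesis
  proof (rule rational_approx_limit)
    fix e :: real assume "e > 0"
    then obtain n where n: "\<And>z. z \<in> cball 0 \<rho> \<Longrightarrow> dist (\<Sum>i<n. (1 / w) * (z / w) ^ i) (1 / (w - z)) < e"
      using uniform_limitD[OF lim, of e] unfolding eventually_sequentially by blast
    have "rational_approx W (cball 0 \<rho>) (\<lambda>z. \<Sum>i<n. (1 / w) * (z / w) ^ i)"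
      by (rule rational_approx_rational[of 1 _ _ _ "\<Sum>i<n. monom (1 / w * (1 / w) ^ i) i"])
        (auto simp: poly_sum poly_monom power_divide)
    then show "\<exists>h. rational_approx W (cball 0 \<rho>) h \<and> (\<forall>z\<in>cball 0 \<rho>. cmod (1 / (w - z) - h z) \<le> e)"
      using n by (metis dist_commute dist_norm less_imp_le)
  qed
qed

text \<open>
  Poles of the approximants that lie in \<open>C\<close> have modulus larger than \<open>n + 1\<close>, so the corresponding
  Cauchy kernels can be replaced by polynomials on the disc of radius \<open>n + 1\<close>.
\<close>

lemma rational_approx_closed:
  fixes C :: "complex set" and n :: real
  assumes "closed C" "C \<noteq> {}" "open U" "C \<subseteq> U" "f holomorphic_on U"
  obtains r where "r > 0" "(\<Union>z\<in>C \<inter> cball 0 n. ball z r) \<subseteq> U"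
    "rational_approx (- (C \<union> (\<Union>z\<in>C \<inter> cball 0 n. ball z r))) (\<Union>z\<in>C \<inter> cball 0 n. ball z r) f"
proof -
  \<comment> \<open>Three nested discs: as \<open>r \<le> 1\<close>, discs of radius
    \<open>r\<close> about points of \<open>C\<close> in \<open>cball 0 n\<close> stay in
    \<open>cball 0 (n + 1)\<close>, and a point of \<open>K\<close> has its nearest point of
    \<open>C\<close> in \<open>cball 0 (n + 2)\<close>, where \<open>r0\<close> is chosen.\<close>
  have "compact (C \<inter> cball 0 (n + 2))"
    by (rule closed_Int_compact[OF assms(1) compact_cball])
  then obtain r0 where r0: "r0 > 0" "(\<Union>x\<in>C \<inter> cball 0 (n + 2). cball x r0) \<subseteq> U"
    by (rule compact_subset_open_imp_cball_epsilon_subset[OF _ assms(3)]) (use assms(4) in auto)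
  define r where "r = min r0 1"
  have r: "r > 0" "r \<le> 1" "r \<le> r0"
    using r0(1) unfolding r_def by auto
  define K where "K = cball 0 (n + 1) \<inter> {z. infdist z C \<le> r}"
  have near: "\<exists>c\<in>C. dist z c = infdist z C" for z
    using infdist_attains_inf[OF assms(1,2), of z] by metis
  have "closed {z. infdist z C \<le> r}"
    by (intro closed_Collect_le continuous_intros)
  then have K: "compact K"
    unfolding K_def by (intro compact_Int_closed compact_cball)
  have KU: "K \<subseteq> U"
  proof
    fix z assume z: "z \<in> K"
    obtain c where c: "c \<in> C" "dist z c = infdist z C"
      using near[of z] by blast
    have "dist z c \<le> r"
      using z c(2) unfolding K_def by simp
    moreover have "cmod c \<le> cmod z + dist z c"
      using norm_triangle_ineq[of z "c - z"] by (simp add: dist_norm norm_minus_commute)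
    moreover have "cmod z \<le> n + 1"
      using z unfolding K_def by simp
    ultimately have "c \<in> C \<inter> cball 0 (n + 2)" "z \<in> cball c r0"
      using r c by (auto simp: dist_commute)
    then show "z \<in> U"
      using r0(2) by blast
  qed
  have sub: "(\<Union>z\<in>C \<inter> cball 0 n. ball z r) \<subseteq> K"
  proof
    fix w assume "w \<in> (\<Union>z\<in>C \<inter> cball 0 n. ball z r)"
    then obtain z where z: "z \<in> C" "cmod z \<le> n" "dist z w < r"
      by auto
    have "infdist w C \<le> r"
      using infdist_le[OF z(1), of w] z(3) by (simp add: dist_commute)
    moreover have "cmod w \<le> cmod z + dist z w"
      using norm_triangle_ineq[of z "w - z"] by (simp add: dist_norm norm_minus_commute)
    ultimately show "w \<in> K"
      using z r unfolding K_def by simp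
  qed
  have "rational_approx (- K \<inter> - C) K (\<lambda>z. 1 / (w - z))" if "w \<notin> K" for w
  proof (cases "w \<in> C")
    case True
    then have "cmod w > n + 1"
      using that r unfolding K_def by simp
    then show ?thesis
      by (rule rational_approx_mono[OF rational_approx_cauchy_kernel]) (auto simp: K_def)
  next
    case False
    then show ?thesis
      using that by (intro rational_approx_rational[of "[:w, -1:]" _ _ _ 1]) auto
  qed
  then have "rational_approx (- K \<inter> - C) (interior K) f"
    by (intro runge_interior[OF K assms(3) KU assms(5)]) auto
  then have "rational_approx (- (C \<union> (\<Union>z\<in>C \<inter> cball 0 n. ball z r))) (\<Union>z\<in>C \<inter> cball 0 n. ball z r) f"
    by (rule rational_approx_mono) (use sub in \<open>auto intro!: interior_maximal[THEN subsetD, OF sub]\<close>)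
  then show ?thesis
    using that r(1) sub KU by blast
qed

section \<open>Pade approximants\<close>

lemma poly_has_fps_expansion: "poly P has_fps_expansion fps_of_poly P" for P :: "complex poly"
proof (induction P)
  case (pCons a P)
  have "(\<lambda>z. a + poly P z * z) has_fps_expansion fps_const a + fps_of_poly P * fps_X"
    by (intro fps_expansion_intros pCons)
  moreover have "poly (pCons a P) = (\<lambda>z. a + poly P z * z)"
    by (auto simp: mult.commute)
  ultimately show ?case
    by (simp only: fps_of_poly_pCons)
qed simp

lemma fps_expansion_rational:
  fixes N D :: "complex poly"
  assumes "coeff D 0 \<noteq> 0"
  shows "fps_of_poly D * fps_expansion (\<lambda>z. poly N z / poly D z) 0 = fps_of_poly N"
proof -
  have "(\<lambda>z. poly N z * inverse (poly D z)) has_fps_expansion fps_of_poly N * inverse (fps_of_poly D)"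
    by (intro has_fps_expansion_mult has_fps_expansion_inverse poly_has_fps_expansion) (simp add: assms)
  then have "fps_expansion (\<lambda>z. poly N z / poly D z) 0 = fps_of_poly N * inverse (fps_of_poly D)"
    by (intro fps_expansion_eqI) (simp add: divide_inverse)
  then show ?thesis
    using inverse_mult_eq_1'[of "fps_of_poly D"] assms by (simp add: mult_ac)
qed

lemma analytic_at_rational:
  fixes N D :: "complex poly"
  assumes "poly D z \<noteq> 0"
  shows "(\<lambda>z. poly N z / poly D z) analytic_on {z}"
proof -
  have "open {z. poly D z \<noteq> 0}"
    by (intro open_Collect_neq continuous_intros)
  moreover have "(\<lambda>z. poly N z / poly D z) holomorphic_on {z. poly D z \<noteq> 0}"
    by (intro holomorphic_intros) auto
  ultimately show ?thesis
    using assms unfolding analytic_at by blast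
qed

lemma fps_mult_agree:
  fixes A B C :: "complex fps"
  assumes "\<And>v. v \<le> n \<Longrightarrow> A $ v = B $ v" "v \<le> n"
  shows "(C * A) $ v = (C * B) $ v"
  using assms by (auto simp: fps_mult_nth intro!: sum.cong)

lemma poly_eq_upto_degree:
  fixes P Q :: "complex poly"
  assumes "degree P \<le> n" "degree Q \<le> n" "\<And>v. v \<le> n \<Longrightarrow> coeff P v = coeff Q v"
  shows "P = Q"
  using assms by (metis coeff_eq_0 le_less_trans not_le poly_eqI)

text \<open>\<open>D\<close> has constant coefficient 1, hence is a unit among power series:
  multiplying by it or by its inverse preserves agreement up to order \<open>p + q\<close>. This
  makes the condition linear in the coefficients of \<open>N\<close> and \<open>D\<close>. Near 0
  the quotient is analytic, so \<open>remove_sings\<close> changes nothing there.\<close>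

lemma is_pade_iff:
  "is_pade p q f r \<longleftrightarrow>
    (\<exists>N D :: complex poly. degree N \<le> p \<and> degree D \<le> q \<and> coeff D 0 = 1 \<and>
       r = remove_sings (\<lambda>z. poly N z / poly D z) \<and>
       (\<forall>v\<le>p+q. coeff N v = (fps_of_poly D * fps_expansion f 0) $ v))"
proof -
  have *: "(\<forall>v\<le>p+q. fps_expansion (remove_sings (\<lambda>z. poly N z / poly D z)) 0 $ v = taylor_coeff f (int v))
      \<longleftrightarrow> (\<forall>v\<le>p+q. coeff N v = (fps_of_poly D * fps_expansion f 0) $ v)"
    if D: "coeff D 0 = 1" for N D :: "complex poly"
  proof -
    define A where "A = fps_expansion f 0"
    define G where "G = fps_expansion (\<lambda>z. poly N z / poly D z) 0"
    have "(\<lambda>z. poly N z / poly D z) analytic_on {0}"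
      using D by (intro analytic_at_rational) (simp add: poly_0_coeff_0)
    then have "fps_expansion (remove_sings (\<lambda>z. poly N z / poly D z)) 0 = G"
      unfolding G_def by (intro fps_expansion_cong eventually_remove_sings_eq_nhds)
    moreover have G: "fps_of_poly D * G = fps_of_poly N"
      unfolding G_def using D by (intro fps_expansion_rational) simp
    moreover have "(\<forall>v\<le>p+q. G $ v = A $ v) \<longleftrightarrow> (\<forall>v\<le>p+q. coeff N v = (fps_of_poly D * A) $ v)"
    proof
      assume "\<forall>v\<le>p+q. G $ v = A $ v"
      then show "\<forall>v\<le>p+q. coeff N v = (fps_of_poly D * A) $ v"
        using fps_mult_agree[of "p + q" G A _ "fps_of_poly D"] unfolding G by simp
    next
      assume "\<forall>v\<le>p+q. coeff N v = (fps_of_poly D * A) $ v"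
      then have "(inverse (fps_of_poly D) * fps_of_poly N) $ v = (inverse (fps_of_poly D) * (fps_of_poly D * A)) $ v"
        if "v \<le> p + q" for v
        using that by (intro fps_mult_agree[of "p + q"]) auto
      moreover have "inverse (fps_of_poly D) * (fps_of_poly D * B) = B" for B
        using inverse_mult_eq_1[of "fps_of_poly D"] D by (simp add: mult.assoc[symmetric])
      ultimately show "\<forall>v\<le>p+q. G $ v = A $ v"
        unfolding G[symmetric] by simp
    qed
    ultimately show ?thesis
      unfolding A_def taylor_coeff_def by simp
  qed
  show ?thesis
    unfolding is_pade_def using * by blast
qed

lemma eventually_at_poly_nonzero:
  fixes D :: "complex poly"
  assumes "D \<noteq> 0"
  shows "\<forall>\<^sub>F w in at z. poly D w \<noteq> 0"
proof -
  have "finite ({w. poly D w = 0} - {z})"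
    using poly_roots_finite[OF assms] by simp
  then have "open (- ({w. poly D w = 0} - {z}))"
    by (intro open_Compl finite_imp_closed)
  then have "\<forall>\<^sub>F w in at z. w \<in> - ({w. poly D w = 0} - {z}) - {z}"
    by (intro eventually_at_in_open) auto
  then show ?thesis
    by eventually_elim auto
qed

text \<open>Uniqueness: for a second solution \<open>M / C\<close>, both \<open>M * D\<close> and
  \<open>N * C\<close> agree with \<open>C * D * f\<close> up to order \<open>p + q\<close> and have
  degree at most \<open>p + q\<close>, so they are equal. The quotients then agree off finitely many
  points, and \<open>remove_sings\<close> turns this into equality of functions.\<close>

lemma pade_eq:
  fixes N D :: "complex poly"
  assumes "degree N \<le> p" "degree D \<le> q" "coeff D 0 = 1"
    and "\<And>v. v \<le> p + q \<Longrightarrow> coeff N v = (fps_of_poly D * fps_expansion f 0) $ v"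
  shows "pade p q f = remove_sings (\<lambda>z. poly N z / poly D z)"
proof -
  define A where "A = fps_expansion f 0"
  have "is_pade p q f (remove_sings (\<lambda>z. poly N z / poly D z))"
    unfolding is_pade_iff using assms by blast
  moreover have "r = remove_sings (\<lambda>z. poly N z / poly D z)" if "is_pade p q f r" for r
  proof -
    obtain M C where MC: "degree M \<le> p" "degree C \<le> q" "coeff C 0 = 1"
      "r = remove_sings (\<lambda>z. poly M z / poly C z)" "\<And>v. v \<le> p + q \<Longrightarrow> coeff M v = (fps_of_poly C * A) $ v"
      using \<open>is_pade p q f r\<close> unfolding is_pade_iff A_def by blast
    have eq: "M * D = N * C"
    proof (rule poly_eq_upto_degree[of _ "p + q"])
      show "degree (M * D) \<le> p + q" "degree (N * C) \<le> p + q"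
        using assms(1,2) MC(1,2) degree_mult_le[of M D] degree_mult_le[of N C] by linarith+
      fix v assume v: "v \<le> p + q"
      have "coeff (M * D) v = (fps_of_poly D * fps_of_poly M) $ v"
        by (metis fps_of_poly_mult fps_of_poly_nth mult.commute)
      also have "\<dots> = (fps_of_poly D * (fps_of_poly C * A)) $ v"
        using MC(5) v by (intro fps_mult_agree[of "p + q"]) auto
      also have "\<dots> = (fps_of_poly C * (fps_of_poly D * A)) $ v"
        by (simp add: mult_ac)
      also have "\<dots> = (fps_of_poly C * fps_of_poly N) $ v"
        using assms(4) v unfolding A_def by (intro fps_mult_agree[of "p + q"]) auto
      also have "\<dots> = coeff (N * C) v"
        by (metis fps_of_poly_mult fps_of_poly_nth mult.commute)
      finally show "coeff (M * D) v = coeff (N * C) v" .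
    qed
    have nz: "C \<noteq> 0" "D \<noteq> 0"
      using MC(3) assms(3) by auto
    show ?thesis
      unfolding MC(4)
    proof (intro ext remove_sings_cong)
      fix z
      show "\<forall>\<^sub>F w in at z. poly M w / poly C w = poly N w / poly D w"
        using eventually_at_poly_nonzero[OF nz(1), of z] eventually_at_poly_nonzero[OF nz(2), of z]
      proof eventually_elim
        case (elim w)
        have "poly M w * poly D w = poly N w * poly C w"
          using eq by (metis poly_mult)
        then show ?case
          using elim by (simp add: field_simps)
      qed
    qed simp
  qed
  ultimately show ?thesis
    unfolding pade_def by (rule the_equality)
qed

section \<open>Hankel systems, numerators and denominators\<close>

definition hankel :: "nat \<Rightarrow> nat \<Rightarrow> (complex \<Rightarrow> complex) \<Rightarrow> complex mat" where
  "hankel p q f = Matrix.mat q q (\<lambda>(i, j). taylor_coeff f (int p - int q + int i + int j + 1))"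

lemma hankel_carrier: "hankel p q f \<in> carrier_mat q q"
  unfolding hankel_def by simp

text \<open>The empty determinant is 1, which absorbs the special case \<open>q = 0\<close> of
  \<open>pade_D\<close>.\<close>

lemma pade_D_iff: "f \<in> pade_D p q \<longleftrightarrow> Determinant.det (hankel p q f) \<noteq> 0"
proof (cases "q = 0")
  case True
  then show ?thesis
    unfolding pade_D_def using det_dim_zero[of "hankel p q f"] hankel_carrier[of p q f] by simp
qed (simp add: pade_D_def hankel_def)

text \<open>The order of the entries is reversed: with \<open>k = q - 1 - j\<close>, the Hankel
  entry with index \<open>p - q + i + j + 1\<close> has index \<open>p + i - k\<close>, so a row of
  the matrix applied to the vector becomes a coefficient of a product of power series.\<close>

definition vec_poly :: "nat \<Rightarrow> complex Matrix.vec \<Rightarrow> complex poly" where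
  "vec_poly q v = (\<Sum>k<q. monom (vec_index v (q - 1 - k)) k)"

lemma coeff_vec_poly: "coeff (vec_poly q v) k = (if k < q then vec_index v (q - 1 - k) else 0)"
  unfolding vec_poly_def by (simp add: coeff_sum)

lemma vec_poly_coeffs:
  assumes "\<And>k. k \<ge> q \<Longrightarrow> coeff E k = 0"
  shows "vec_poly q (Matrix.vec q (\<lambda>j. coeff E (q - 1 - j))) = E"
  using assms by (intro poly_eqI) (auto simp: coeff_vec_poly not_less)

lemma taylor_coeff_diff:
  assumes "b \<le> a"
  shows "taylor_coeff f (int a - int b) = fps_expansion f 0 $ (a - b)"
proof -
  have "nat (int a - int b) = a - b"
    using assms by linarith
  then show ?thesis
    using assms unfolding taylor_coeff_def by simp
qed

lemma hankel_mult_vec: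
  assumes "v \<in> carrier_vec q" "i < q"
  shows "vec_index (hankel p q f *\<^sub>v v) i = (fps_of_poly (vec_poly q v) * fps_expansion f 0) $ (p + i)"
proof -
  have "(fps_of_poly (vec_poly q v) * fps_expansion f 0) $ (p + i)
      = (\<Sum>k=0..p+i. coeff (vec_poly q v) k * taylor_coeff f (int (p + i) - int k))"
    unfolding fps_mult_nth by (intro sum.cong refl) (simp add: taylor_coeff_diff del: of_nat_add)
  \<comment> \<open>The two ranges differ only in zero terms: the coefficients of
    \<open>vec_poly\<close> vanish for \<open>k \<ge> q\<close>, and the Taylor coefficients of
    negative index for \<open>k > p + i\<close>.\<close>
  also have "\<dots> = (\<Sum>k<q. coeff (vec_poly q v) k * taylor_coeff f (int (p + i) - int k))"
    by (intro sum.mono_neutral_cong) (auto simp: coeff_vec_poly taylor_coeff_def)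
  also have "\<dots> = (\<Sum>k<q. coeff (vec_poly q v) (q - Suc k) * taylor_coeff f (int (p + i) - int (q - Suc k)))"
    by (rule sum.nat_diff_reindex[symmetric])
  also have "\<dots> = (\<Sum>k<q. hankel p q f $$ (i, k) * vec_index v k)"
    using assms(2) by (intro sum.cong) (auto simp: coeff_vec_poly hankel_def of_nat_diff algebra_simps)
  also have "\<dots> = vec_index (hankel p q f *\<^sub>v v) i"
    using assms hankel_carrier[of p q f]
    by (auto simp: scalar_prod_def atLeast0LessThan intro!: sum.cong)
  finally show ?thesis
    by simp
qed

text \<open>Regularity of the Hankel matrix as triviality of its kernel, with kernel vectors read as
  polynomials of degree below \<open>q\<close>. Both later uses argue with degrees and
  divisibility.\<close>

lemma pade_D_iff_kernel:
  "f \<in> pade_D p q \<longleftrightarrow>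
    (\<forall>E. (\<forall>k\<ge>q. coeff E k = 0) \<longrightarrow>
      (\<forall>i<q. (fps_of_poly E * fps_expansion f 0) $ (p + i) = 0) \<longrightarrow> E = 0)" (is "_ \<longleftrightarrow> ?rhs")
proof -
  have zero: "hankel p q f *\<^sub>v v = 0\<^sub>v q \<longleftrightarrow>
      (\<forall>i<q. (fps_of_poly (vec_poly q v) * fps_expansion f 0) $ (p + i) = 0)"
    if "v \<in> carrier_vec q" for v
    using hankel_mult_vec[OF that] hankel_carrier[of p q f] by (auto simp: vec_eq_iff simp del: index_mult_mat_vec)
  have "f \<notin> pade_D p q \<longleftrightarrow> (\<exists>v. v \<in> carrier_vec q \<and> v \<noteq> 0\<^sub>v q \<and> hankel p q f *\<^sub>v v = 0\<^sub>v q)"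
    unfolding pade_D_iff using det_0_iff_vec_prod_zero[OF hankel_carrier] by simp
  also have "\<dots> \<longleftrightarrow> \<not> ?rhs"
  proof
    assume "\<exists>v. v \<in> carrier_vec q \<and> v \<noteq> 0\<^sub>v q \<and> hankel p q f *\<^sub>v v = 0\<^sub>v q"
    then obtain v where v: "v \<in> carrier_vec q" "v \<noteq> 0\<^sub>v q" "hankel p q f *\<^sub>v v = 0\<^sub>v q"
      by blast
    have "vec_poly q v \<noteq> 0"
    proof
      assume "vec_poly q v = 0"
      then have "vec_index v j = 0" if "j < q" for j
        using that coeff_vec_poly[of q v "q - 1 - j"] by simp
      then show False
        using v(1,2) by (auto simp: vec_eq_iff)
    qed
    moreover have "\<forall>k\<ge>q. coeff (vec_poly q v) k = 0"
      by (simp add: coeff_vec_poly)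
    ultimately show "\<not> ?rhs"
      using v(3) zero[OF v(1)] by blast
  next
    assume "\<not> ?rhs"
    then obtain E where E: "\<And>k. k \<ge> q \<Longrightarrow> coeff E k = 0"
      "\<forall>i<q. (fps_of_poly E * fps_expansion f 0) $ (p + i) = 0" "E \<noteq> 0"
      by blast
    define v where "v = Matrix.vec q (\<lambda>j. coeff E (q - 1 - j))"
    have v: "v \<in> carrier_vec q" "vec_poly q v = E"
      unfolding v_def using vec_poly_coeffs E(1) by auto
    have "v \<noteq> 0\<^sub>v q"
    proof
      assume "v = 0\<^sub>v q"
      then have "vec_poly q v = 0"
        by (intro poly_eqI) (simp add: coeff_vec_poly)
      then show False
        using v E(3) by simp
    qed
    then show "\<exists>v. v \<in> carrier_vec q \<and> v \<noteq> 0\<^sub>v q \<and> hankel p q f *\<^sub>v v = 0\<^sub>v q"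
      using zero[OF v(1)] v E(2) by auto
  qed
  finally show ?thesis
    by blast
qed

text \<open>Cramer's rule, so that the coefficients depend continuously on the Taylor coefficients.\<close>

definition pade_vec :: "nat \<Rightarrow> nat \<Rightarrow> (complex \<Rightarrow> complex) \<Rightarrow> complex Matrix.vec" where
  "pade_vec p q f = inverse (Determinant.det (hankel p q f)) \<cdot>\<^sub>v
     (adj_mat (hankel p q f) *\<^sub>v Matrix.vec q (\<lambda>i. - taylor_coeff f (int (p + 1 + i))))"

text \<open>Writing the denominator as \<open>1 + z * E\<close>, the conditions at the orders
  \<open>p + 1, ..., p + q\<close> are the linear system solved by \<open>pade_vec\<close>. If the
  determinant is 0, then \<open>inverse 0 = 0\<close> makes this the constant 1, so the degree
  bounds hold for every \<open>f\<close> and not only on \<open>pade_D\<close>.\<close>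

definition pade_den :: "nat \<Rightarrow> nat \<Rightarrow> (complex \<Rightarrow> complex) \<Rightarrow> complex poly" where
  "pade_den p q f = pCons 1 (vec_poly q (pade_vec p q f))"

definition pade_num :: "nat \<Rightarrow> nat \<Rightarrow> (complex \<Rightarrow> complex) \<Rightarrow> complex poly" where
  "pade_num p q f = (\<Sum>i\<le>p. monom ((fps_of_poly (pade_den p q f) * fps_expansion f 0) $ i) i)"

lemma coeff_pade_num:
  "coeff (pade_num p q f) i = (if i \<le> p then (fps_of_poly (pade_den p q f) * fps_expansion f 0) $ i else 0)"
  unfolding pade_num_def by (simp add: coeff_sum)

lemma degree_pade_den: "degree (pade_den p q f) \<le> q"
  unfolding pade_den_def by (rule degree_le) (auto simp: coeff_pCons coeff_vec_poly split: nat.split)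

lemma degree_pade_num: "degree (pade_num p q f) \<le> p"
  by (rule degree_le) (simp add: coeff_pade_num)

lemma coeff_0_pade_den: "coeff (pade_den p q f) 0 = 1"
  unfolding pade_den_def by simp

lemma hankel_mult_pade_vec:
  assumes "f \<in> pade_D p q"
  shows "hankel p q f *\<^sub>v pade_vec p q f = Matrix.vec q (\<lambda>i. - taylor_coeff f (int (p + 1 + i)))"
proof -
  define H where "H = hankel p q f"
  define b where "b = Matrix.vec q (\<lambda>i. - taylor_coeff f (int (p + 1 + i)))"
  have H: "H \<in> carrier_mat q q" "Determinant.det H \<noteq> 0" and b: "b \<in> carrier_vec q"
    using assms hankel_carrier[of p q f] unfolding H_def b_def pade_D_iff by simp_all
  note adj = adj_mat[OF H(1)]
  have "H *\<^sub>v (inverse (Determinant.det H) \<cdot>\<^sub>v (adj_mat H *\<^sub>v b))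
      = inverse (Determinant.det H) \<cdot>\<^sub>v ((H * adj_mat H) *\<^sub>v b)"
    using H(1) adj(1) b by (simp add: mult_mat_vec[of _ q q] assoc_mult_mat_vec[of _ q q _ q])
  also have "\<dots> = inverse (Determinant.det H) \<cdot>\<^sub>v (Determinant.det H \<cdot>\<^sub>v b)"
    using b by (auto simp: adj(2) vec_eq_iff scalar_prod_def if_distrib[of "\<lambda>x. _ * x * _"] if_distrib[of "\<lambda>x. x * _"] cong: if_cong)
  also have "\<dots> = b"
    using H(2) b by (simp add: smult_smult_assoc)
  finally show ?thesis
    unfolding pade_vec_def H_def b_def .
qed

lemma pade_vec_carrier: "pade_vec p q f \<in> carrier_vec q"
  unfolding pade_vec_def using adj_mat(1)[OF hankel_carrier[of p q f]] by simp

text \<open>Up to order \<open>p\<close> this is the choice of the numerator. Beyond it, the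
  coefficient of order \<open>p + 1 + i\<close> is that of \<open>f\<close> plus the coefficient of
  order \<open>p + i\<close> of \<open>E * f\<close>, where the denominator is
  \<open>1 + z * E\<close>; row \<open>i\<close> of the Hankel system makes the two cancel.\<close>

lemma pade_num_den:
  assumes "f \<in> pade_D p q" "v \<le> p + q"
  shows "coeff (pade_num p q f) v = (fps_of_poly (pade_den p q f) * fps_expansion f 0) $ v"
proof (cases "v \<le> p")
  case False
  define A where "A = fps_expansion f 0"
  define E where "E = vec_poly q (pade_vec p q f)"
  define i where "i = v - p - 1"
  have i: "v = Suc (p + i)" "i < q"
    unfolding i_def using False assms(2) by auto
  have "fps_of_poly (pade_den p q f) * A = A + fps_of_poly E * A * fps_X"
    unfolding pade_den_def E_def by (simp add: fps_of_poly_pCons algebra_simps)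
  then have "(fps_of_poly (pade_den p q f) * A) $ v = A $ v + (fps_of_poly E * A) $ (p + i)"
    by (simp add: i(1))
  also have "(fps_of_poly E * A) $ (p + i) = - taylor_coeff f (int (p + 1 + i))"
    unfolding A_def E_def hankel_mult_vec[OF pade_vec_carrier i(2), symmetric] hankel_mult_pade_vec[OF assms(1)]
    using i(2) by simp
  also have "\<dots> = - A $ v"
    unfolding A_def taylor_coeff_def i(1) by (simp add: nat_add_distrib)
  finally show ?thesis
    using False unfolding A_def by (simp add: coeff_pade_num)
qed (simp add: coeff_pade_num)

lemma pade_eq_num_den:
  assumes "f \<in> pade_D p q"
  shows "pade p q f = remove_sings (\<lambda>z. poly (pade_num p q f) z / poly (pade_den p q f) z)"
  using pade_num_den[OF assms]
  by (intro pade_eq degree_pade_num degree_pade_den coeff_0_pade_den) auto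


text \<open>If a linear factor \<open>L\<close> could be cancelled, the remaining \<open>N\<close>
  and \<open>D\<close> would have degrees below \<open>p\<close> and \<open>q\<close>, and
  \<open>D * f\<close> would still agree with \<open>N\<close> up to order \<open>p + q\<close>.
  Then the coefficients of \<open>D * f\<close> at \<open>p, ..., p + q - 1\<close> vanish, so
  \<open>D\<close> is a nonzero kernel element.\<close>

lemma pade_num_den_no_common_root:
  assumes "f \<in> pade_D p q" "poly (pade_den p q f) z = 0"
  shows "poly (pade_num p q f) z \<noteq> 0"
proof
  assume "poly (pade_num p q f) z = 0"
  define A where "A = fps_expansion f 0"
  define L where "L = [:- z, 1:]"
  obtain N where N: "pade_num p q f = L * N"
    using \<open>poly (pade_num p q f) z = 0\<close> unfolding L_def poly_eq_0_iff_dvd by (elim dvdE)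
  obtain D where D: "pade_den p q f = L * D"
    using assms(2) unfolding L_def poly_eq_0_iff_dvd by (elim dvdE)
  have "D \<noteq> 0"
    using D coeff_0_pade_den[of p q f] by auto
  have deg: "degree (L * P) = Suc (degree P)" if "P \<noteq> 0" for P
    using degree_mult_eq[of L P] that unfolding L_def by (simp del: mult_pCons_left)
  have Dq: "coeff D k = 0" if "k \<ge> q" for k
    using that deg[OF \<open>D \<noteq> 0\<close>] degree_pade_den[of p q f] unfolding D by (intro coeff_eq_0) simp
  have Np: "coeff N k = 0" if "k \<ge> p" for k
  proof (cases "N = 0")
    case False
    then show ?thesis
      using that deg[OF False] degree_pade_num[of p q f] unfolding N by (intro coeff_eq_0) simp
  qed simp
  \<comment> \<open>The constant coefficient of \<open>L\<close> divides 1, so \<open>L\<close> is a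
    unit among power series and can be cancelled.\<close>
  have "coeff L 0 \<noteq> 0"
    using D coeff_0_pade_den[of p q f] by (metis coeff_mult_0 mult_zero_left zero_neq_one)
  then have inv: "inverse (fps_of_poly L) * (fps_of_poly L * B) = B" for B
    using inverse_mult_eq_1[of "fps_of_poly L"] by (simp add: mult.assoc[symmetric])
  have "(fps_of_poly D * A) $ (p + i) = 0" if "i < q" for i
  proof -
    have "(inverse (fps_of_poly L) * (fps_of_poly L * fps_of_poly N)) $ (p + i)
        = (inverse (fps_of_poly L) * (fps_of_poly L * (fps_of_poly D * A))) $ (p + i)"
    proof (rule fps_mult_agree[of "p + q"])
      show "(fps_of_poly L * fps_of_poly N) $ v = (fps_of_poly L * (fps_of_poly D * A)) $ v" if "v \<le> p + q" for v
        using pade_num_den[OF assms(1) that]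
        unfolding N D A_def by (simp add: fps_of_poly_mult[symmetric] mult.assoc[symmetric])
    qed (use that in simp)
    then show ?thesis
      using Np[of "p + i"] by (simp add: inv)
  qed
  then have "D = 0"
    using assms(1) Dq unfolding pade_D_iff_kernel A_def by blast
  then show False
    using \<open>D \<noteq> 0\<close> by contradiction
qed

lemma not_is_pole_pade_iff:
  assumes "f \<in> pade_D p q"
  shows "\<not> is_pole (pade p q f) z \<longleftrightarrow> poly (pade_den p q f) z \<noteq> 0"
proof -
  define N D where "N = pade_num p q f" and "D = pade_den p q f"
  have r: "pade p q f = remove_sings (\<lambda>z. poly N z / poly D z)"
    unfolding N_def D_def by (rule pade_eq_num_den[OF assms])
  have "D \<noteq> 0"
    using coeff_0_pade_den[of p q f] unfolding D_def by auto
  show ?thesis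
  proof (cases "poly D z = 0")
    case True
    have N: "poly N z \<noteq> 0"
      using pade_num_den_no_common_root[OF assms] True unfolding N_def D_def by blast
    have nz: "\<forall>\<^sub>F w in at z. poly D w \<noteq> 0"
      by (rule eventually_at_poly_nonzero[OF \<open>D \<noteq> 0\<close>])
    have "isCont (poly D) z"
      by (intro continuous_intros)
    then have "filterlim (poly D) (at 0) (at z)"
      using True nz by (auto simp: filterlim_at isCont_def)
    then have pole: "is_pole (\<lambda>z. poly N z / poly D z) z"
      using N by (intro is_pole_divide continuous_intros) auto
    obtain e where e: "e > 0" "\<And>w. w \<in> ball z e - {z} \<Longrightarrow> poly D w \<noteq> 0"
      using nz by (auto simp: eventually_at dist_commute)
    \<comment> \<open>This makes \<open>remove_sings\<close> agree with the quotient around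
      \<open>z\<close>, so that the pole survives.\<close>
    have "isolated_singularity_at (\<lambda>z. poly N z / poly D z) z"
      unfolding isolated_singularity_at_def
    proof (intro exI conjI)
      show "(\<lambda>z. poly N z / poly D z) analytic_on ball z e - {z}"
        using analytic_at_rational e(2) by (subst analytic_on_analytic_at) blast
    qed (rule e(1))
    then have "is_pole (remove_sings (\<lambda>z. poly N z / poly D z)) z"
      using pole is_pole_cong[OF eventually_remove_sings_eq_at refl] by blast
    then show ?thesis
      using True unfolding r D_def by blast
  next
    case False
    then have "remove_sings (\<lambda>z. poly N z / poly D z) analytic_on {z}"
      by (intro remove_sings_analytic_on analytic_at_rational)
    then show ?thesis
      using False analytic_at_imp_no_pole unfolding r D_def by blast
  qed
qed

lemma higher_deriv_pade:
  assumes "f \<in> pade_D p q" "poly (pade_den p q f) z \<noteq> 0"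
  shows "(deriv ^^ l) (pade p q f) z = (deriv ^^ l) (\<lambda>z. poly (pade_num p q f) z / poly (pade_den p q f) z) z"
  unfolding pade_eq_num_den[OF assms(1)]
  by (intro higher_deriv_cong_ev eventually_remove_sings_eq_nhds analytic_at_rational assms(2) refl)

section \<open>Rational functions in lowest terms\<close>

text \<open>Euclid's lemma, with coprimality expressed by roots: over the complex numbers
  \<open>N\<close> splits, and each linear factor, having no root in common with \<open>D\<close>,
  must divide \<open>S\<close>; the factors are stripped off one at a time.\<close>

lemma dvd_mult_no_common_root:
  fixes N D S :: "complex poly"
  assumes "N \<noteq> 0" "\<And>z. poly N z = 0 \<Longrightarrow> poly D z \<noteq> 0" "N dvd D * S"
  shows "N dvd S"
  using assms
proof (induction "degree N" arbitrary: N S)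
  case 0
  then obtain c where "N = [:c:]" "c \<noteq> 0"
    by (metis degree_eq_zeroE pCons_0_0)
  then have "is_unit N"
    by (simp add: is_unit_const_poly_iff dvd_field_iff)
  then show ?case
    by (rule unit_imp_dvd)
next
  case (Suc n)
  then obtain a where a: "poly N a = 0"
    using Fundamental_Theorem_Algebra.fundamental_theorem_of_algebra[of N] by (auto simp: constant_degree)
  define L where "L = [:- a, 1:]"
  have "L \<noteq> 0"
    unfolding L_def by simp
  obtain M where M: "N = L * M"
    using a unfolding L_def poly_eq_0_iff_dvd by (elim dvdE)
  have "poly (D * S) a = 0"
    using Suc.prems(3) a by (metis dvdE mult_zero_left poly_mult)
  then have "poly S a = 0"
    using Suc.prems(2)[OF a] by simp
  then obtain T where T: "S = L * T"
    unfolding L_def poly_eq_0_iff_dvd by (elim dvdE)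
  have "M \<noteq> 0"
    using M Suc.prems(1) by auto
  then have "degree N = Suc (degree M)"
    using degree_mult_eq[OF \<open>L \<noteq> 0\<close>, of M] unfolding M L_def by simp
  moreover have "L * M dvd L * (D * T)"
    using Suc.prems(3) unfolding M T by (simp add: mult.left_commute)
  then have "M dvd D * T"
    using \<open>L \<noteq> 0\<close> by simp
  ultimately have "M dvd T"
    using Suc.hyps(1)[of M T] Suc.hyps(2) Suc.prems(2) \<open>M \<noteq> 0\<close> unfolding M by auto
  then show ?case
    unfolding M T by simp
qed

text \<open>Common roots are cancelled one by one, the degree of \<open>Q\<close> dropping each
  time. That the roots of \<open>D\<close> are among those of \<open>Q\<close> keeps the poles where
  Runge's theorem has put them.\<close>

lemma rational_lowest_terms:
  fixes P Q :: "complex poly"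
  assumes "Q \<noteq> 0"
  obtains N D where "N * Q = P * D" "D \<noteq> 0" "\<And>z. poly D z = 0 \<Longrightarrow> poly Q z = 0"
    "\<And>z. poly N z = 0 \<Longrightarrow> poly D z \<noteq> 0"
proof -
  have "\<exists>N D. N * Q = P * D \<and> D \<noteq> 0 \<and> (\<forall>z. poly D z = 0 \<longrightarrow> poly Q z = 0) \<and> (\<forall>z. poly N z = 0 \<longrightarrow> poly D z \<noteq> 0)"
    using assms
  proof (induction "degree Q" arbitrary: P Q rule: less_induct)
    case less
    show ?case
    proof (cases "\<exists>a. poly P a = 0 \<and> poly Q a = 0")
      case True
      then obtain a where a: "poly P a = 0" "poly Q a = 0"
        by blast
      define L where "L = [:- a, 1:]"
      have "L \<noteq> 0"
        unfolding L_def by simp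
      obtain P' where P': "P = L * P'"
        using a(1) unfolding L_def poly_eq_0_iff_dvd by (elim dvdE)
      obtain Q' where Q': "Q = L * Q'"
        using a(2) unfolding L_def poly_eq_0_iff_dvd by (elim dvdE)
      have "Q' \<noteq> 0"
        using less.prems Q' by auto
      then have "degree Q = Suc (degree Q')"
        using degree_mult_eq[OF \<open>L \<noteq> 0\<close>, of Q'] unfolding Q' L_def by simp
      then obtain N D where "N * Q' = P' * D" "D \<noteq> 0" "\<forall>z. poly D z = 0 \<longrightarrow> poly Q' z = 0"
        "\<forall>z. poly N z = 0 \<longrightarrow> poly D z \<noteq> 0"
        using less.hyps[of Q' P'] \<open>Q' \<noteq> 0\<close> by auto
      moreover from this have "N * Q = P * D"
        unfolding P' Q' by (simp add: mult_ac)
      ultimately show ?thesis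
        unfolding Q' by (metis mult_zero_right poly_mult)
    next
      case False
      then show ?thesis
        using less.prems by (intro exI[of _ P] exI[of _ Q]) auto
    qed
  qed
  then show ?thesis
    using that by blast
qed

text \<open>For a kernel element \<open>E\<close>, the series \<open>E * f\<close> agrees below
  order \<open>p + q\<close> with its truncation \<open>S\<close> of degree below \<open>p\<close>.
  Multiplying by \<open>D\<close> gives \<open>E * N = D * S\<close>, as both sides have degree
  below \<open>p + q\<close> unless they vanish. So \<open>N\<close> divides \<open>S\<close>; since
  \<open>N\<close> has degree exactly \<open>p\<close>, this forces \<open>S = 0\<close> and
  \<open>E = 0\<close>.\<close>

lemma rational_in_pade_D:
  fixes N D :: "complex poly"
  assumes "fps_of_poly D * fps_expansion f 0 = fps_of_poly N" "\<And>z. poly N z = 0 \<Longrightarrow> poly D z \<noteq> 0" "N \<noteq> 0"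
    "degree N = p" "degree D \<le> q"
  shows "f \<in> pade_D p q"
  unfolding pade_D_iff_kernel
proof (intro allI impI)
  fix E
  assume E: "\<forall>k\<ge>q. coeff E k = 0" "\<forall>i<q. (fps_of_poly E * fps_expansion f 0) $ (p + i) = 0"
  define S where "S = (\<Sum>i<p. monom ((fps_of_poly E * fps_expansion f 0) $ i) i)"
  have S: "coeff S i = (if i < p then (fps_of_poly E * fps_expansion f 0) $ i else 0)" for i
    unfolding S_def by (simp add: coeff_sum)
  show "E = 0"
  proof (rule ccontr)
    assume "E \<noteq> 0"
    then have degE: "degree E < q"
      using E(1) by (metis leading_coeff_0_iff not_le)
    have degS: "degree S \<le> p - 1"
      using S by (intro degree_le) auto
    have "E * N = D * S"
    proof (rule poly_eq_upto_degree[of _ "p + q - 1"])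
      show "degree (E * N) \<le> p + q - 1"
        using degree_mult_le[of E N] degE assms(4) by linarith
      show "degree (D * S) \<le> p + q - 1"
      \<comment> \<open>For \<open>p = 0\<close> the truncated \<open>p - 1\<close> only bounds
        \<open>degree S\<close> by 0, which would allow \<open>D * S\<close> degree
        \<open>q\<close>; but then \<open>S\<close> is an empty sum.\<close>
      proof (cases "p = 0")
        case True
        then have "S = 0"
          by (intro poly_eqI) (simp add: S)
        then show ?thesis
          by simp
      next
        case False
        then show ?thesis
          using degree_mult_le[of D S] degS assms(5) by linarith
      qed
      fix v assume v: "v \<le> p + q - 1"
      have "coeff (E * N) v = (fps_of_poly D * (fps_of_poly E * fps_expansion f 0)) $ v"
        by (metis assms(1) fps_of_poly_mult fps_of_poly_nth mult.left_commute)
      also have "\<dots> = (fps_of_poly D * fps_of_poly S) $ v"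
      proof (rule fps_mult_agree[OF _ v])
        fix u assume u: "u \<le> p + q - 1"
        show "(fps_of_poly E * fps_expansion f 0) $ u = fps_of_poly S $ u"
          using E(2)[rule_format, of "u - p"] u degE by (cases "u < p") (auto simp: S)
      qed
      also have "\<dots> = coeff (D * S) v"
        by (metis fps_of_poly_mult fps_of_poly_nth)
      finally show "coeff (E * N) v = coeff (D * S) v" .
    qed
    then have "N dvd D * S"
      by (metis dvd_triv_right)
    then have "N dvd S"
      using dvd_mult_no_common_root assms(2,3) by blast
    moreover have "S \<noteq> 0"
      using \<open>E * N = D * S\<close> \<open>E \<noteq> 0\<close> assms(3) by auto
    ultimately have "p \<le> degree S"
      using dvd_imp_degree_le assms(4) by blast
    moreover have "coeff S (degree S) \<noteq> 0"
      using \<open>S \<noteq> 0\<close> by simp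
    ultimately show False
      using S[of "degree S"] by (simp split: if_splits)
  qed
qed

section \<open>Continuity in the Taylor coefficients\<close>

text \<open>By the Leibniz formula the determinant is a polynomial in the entries.\<close>

lemma tendsto_det:
  fixes M :: "'b \<Rightarrow> complex mat"
  assumes "\<And>k. M k \<in> carrier_mat n n" "M' \<in> carrier_mat n n"
    and "\<And>i j. i < n \<Longrightarrow> j < n \<Longrightarrow> ((\<lambda>k. M k $$ (i, j)) \<longlongrightarrow> M' $$ (i, j)) G"
  shows "((\<lambda>k. Determinant.det (M k)) \<longlongrightarrow> Determinant.det M') G"
  unfolding Determinant.det_def'[OF assms(1)] Determinant.det_def'[OF assms(2)]
proof (intro tendsto_sum tendsto_mult tendsto_const tendsto_prod assms(3))
  fix s i
  assume s: "s \<in> {s. s permutes {0..<n}}" and i: "i \<in> {0..<n}"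
  then show "i < n" "s i < n"
    using permutes_in_image[of s "{0..<n}" i] by simp_all
qed

lemma tendsto_adj_mat:
  fixes M :: "'b \<Rightarrow> complex mat"
  assumes "\<And>k. M k \<in> carrier_mat n n" "M' \<in> carrier_mat n n"
    and lim: "\<And>i j. i < n \<Longrightarrow> j < n \<Longrightarrow> ((\<lambda>k. M k $$ (i, j)) \<longlongrightarrow> M' $$ (i, j)) G"
    and "i < n" "j < n"
  shows "((\<lambda>k. adj_mat (M k) $$ (i, j)) \<longlongrightarrow> adj_mat M' $$ (i, j)) G"
proof -
  have lim_det: "((\<lambda>k. Determinant.det (mat_delete (M k) j i)) \<longlongrightarrow> Determinant.det (mat_delete M' j i)) G"
  proof (rule tendsto_det[of _ "n - 1"])
    fix a b assume "a < n - 1" "b < n - 1"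
    then show "((\<lambda>k. mat_delete (M k) j i $$ (a, b)) \<longlongrightarrow> mat_delete M' j i $$ (a, b)) G"
      using carrier_matD[OF assms(1)] carrier_matD[OF assms(2)] by (simp add: mat_delete_def lim)
  qed (rule mat_delete_carrier[OF assms(1)] mat_delete_carrier[OF assms(2)])+
  have adj: "adj_mat A $$ (i, j) = (- 1) ^ (j + i) * Determinant.det (mat_delete A j i)"
    if "A \<in> carrier_mat n n" for A :: "complex mat"
    using carrier_matD[OF that] assms(4,5) unfolding adj_mat_def cofactor_def by simp
  show ?thesis
    unfolding adj[OF assms(1)] adj[OF assms(2)] by (rule tendsto_mult_left[OF lim_det])
qed

context
  fixes g :: "'b \<Rightarrow> complex \<Rightarrow> complex" and f :: "complex \<Rightarrow> complex" and G :: "'b filter" and p q :: nat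
  assumes lim: "\<And>v. ((\<lambda>k. fps_expansion (g k) 0 $ v) \<longlongrightarrow> fps_expansion f 0 $ v) G"
    and f: "f \<in> pade_D p q"
begin

lemma tendsto_taylor_coeff: "((\<lambda>k. taylor_coeff (g k) v) \<longlongrightarrow> taylor_coeff f v) G"
  unfolding taylor_coeff_def by (auto intro: lim)

lemma tendsto_hankel:
  assumes "i < q" "j < q"
  shows "((\<lambda>k. hankel p q (g k) $$ (i, j)) \<longlongrightarrow> hankel p q f $$ (i, j)) G"
  unfolding hankel_def using assms by (simp add: tendsto_taylor_coeff)

lemma tendsto_det_hankel: "((\<lambda>k. Determinant.det (hankel p q (g k))) \<longlongrightarrow> Determinant.det (hankel p q f)) G"
  by (rule tendsto_det[where M = "\<lambda>k. hankel p q (g k)" and n = q]) (simp_all add: hankel_carrier tendsto_hankel)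

lemma eventually_in_pade_D: "\<forall>\<^sub>F k in G. g k \<in> pade_D p q"
  using f unfolding pade_D_iff by (rule tendsto_imp_eventually_ne[OF tendsto_det_hankel])

lemma tendsto_coeff_pade_den: "((\<lambda>k. coeff (pade_den p q (g k)) i) \<longlongrightarrow> coeff (pade_den p q f) i) G"
proof -
  have eq: "vec_index (pade_vec p q h) i = inverse (Determinant.det (hankel p q h)) *
      (\<Sum>j=0..<q. adj_mat (hankel p q h) $$ (i, j) * - taylor_coeff h (int (p + 1 + j)))" if "i < q" for h i
    using that adj_mat(1)[OF hankel_carrier[of p q h]] by (simp add: pade_vec_def scalar_prod_def)
  have "((\<lambda>k. vec_index (pade_vec p q (g k)) i) \<longlongrightarrow> vec_index (pade_vec p q f) i) G" if "i < q" for i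
    unfolding eq[OF that]
  proof (intro tendsto_mult tendsto_inverse tendsto_sum tendsto_minus tendsto_det_hankel tendsto_taylor_coeff)
    show "Determinant.det (hankel p q f) \<noteq> 0"
      using f unfolding pade_D_iff .
    show "((\<lambda>k. adj_mat (hankel p q (g k)) $$ (i, j)) \<longlongrightarrow> adj_mat (hankel p q f) $$ (i, j)) G"
      if "j \<in> {0..<q}" for j
      using that \<open>i < q\<close>
      by (intro tendsto_adj_mat[where M = "\<lambda>k. hankel p q (g k)" and n = q] hankel_carrier tendsto_hankel) simp_all
  qed
  then show ?thesis
    unfolding pade_den_def by (auto simp: coeff_pCons coeff_vec_poly split: nat.split)
qed

lemma tendsto_coeff_pade_num: "((\<lambda>k. coeff (pade_num p q (g k)) i) \<longlongrightarrow> coeff (pade_num p q f) i) G"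
proof (cases "i \<le> p")
  case True
  have "((\<lambda>k. \<Sum>j=0..i. coeff (pade_den p q (g k)) j * fps_expansion (g k) 0 $ (i - j)) \<longlongrightarrow>
      (\<Sum>j=0..i. coeff (pade_den p q f) j * fps_expansion f 0 $ (i - j))) G"
    by (intro tendsto_sum tendsto_mult tendsto_coeff_pade_den lim)
  then show ?thesis
    using True by (simp add: coeff_pade_num fps_mult_nth)
qed (simp add: coeff_pade_num)

end

section \<open>Convergence of rational functions and their derivatives\<close>

text \<open>Cauchy's estimate on the disc of half the radius, whose closure lies in the open disc of
  holomorphy; the case \<open>l = 0\<close> is the hypothesis at the centre.\<close>

lemma higher_deriv_diff_bound:
  assumes "f holomorphic_on ball z r" "g holomorphic_on ball z r" "r > 0"
    and "\<And>w. w \<in> ball z r \<Longrightarrow> cmod (f w - g w) < B"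
  shows "cmod ((deriv ^^ l) f z - (deriv ^^ l) g z) \<le> fact l * B / (r / 2) ^ l"
proof (cases "l = 0")
  case True
  then show ?thesis
    using assms(4)[of z] assms(3) by simp
next
  case False
  have hol: "(\<lambda>w. f w - g w) holomorphic_on ball z r"
    by (intro holomorphic_intros assms)
  have sub: "cball z (r / 2) \<subseteq> ball z r" "ball z (r / 2) \<subseteq> ball z r"
    using assms(3) by auto
  have "cmod ((deriv ^^ l) (\<lambda>w. f w - g w) z) \<le> fact l * B / (r / 2) ^ l"
  proof (rule Cauchy_higher_deriv_bound)
    show "(\<lambda>w. f w - g w) holomorphic_on ball z (r / 2)"
      by (rule holomorphic_on_subset[OF hol sub(2)])
    show "continuous_on (cball z (r / 2)) (\<lambda>w. f w - g w)"
      by (rule continuous_on_subset[OF holomorphic_on_imp_continuous_on[OF hol] sub(1)])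
    show "f w - g w \<in> ball 0 B" if "w \<in> ball z (r / 2)" for w
      using assms(4) that sub(2) by auto
  qed (use assms(3) False in auto)
  also have "(deriv ^^ l) (\<lambda>w. f w - g w) z = (deriv ^^ l) f z - (deriv ^^ l) g z"
    by (rule higher_deriv_diff[OF assms(1,2)]) (use assms(3) in auto)
  finally show ?thesis .
qed

lemma uniform_limit_poly:
  fixes P :: "'b \<Rightarrow> complex poly"
  assumes "\<And>i. ((\<lambda>k. coeff (P k) i) \<longlongrightarrow> coeff P' i) G" "\<And>k. degree (P k) \<le> n" "degree P' \<le> n" "bounded K"
  shows "uniform_limit K (\<lambda>k. poly (P k)) (poly P') G"
proof (rule uniform_limitI)
  fix e :: real assume "e > 0"
  obtain R where R: "\<And>z. z \<in> K \<Longrightarrow> cmod z \<le> R"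
    using assms(4) by (auto simp: bounded_iff)
  have poly: "poly Q z = (\<Sum>i\<le>n. coeff Q i * z ^ i)" if "degree Q \<le> n" for Q :: "complex poly" and z
    unfolding poly_altdef using that by (intro sum.mono_neutral_left) (auto simp: coeff_eq_0)
  have "((\<lambda>k. \<Sum>i\<le>n. cmod (coeff (P k) i - coeff P' i) * R ^ i) \<longlongrightarrow> (\<Sum>i\<le>n. cmod (coeff P' i - coeff P' i) * R ^ i)) G"
    by (intro tendsto_sum tendsto_mult tendsto_norm tendsto_diff assms(1) tendsto_const)
  then have "((\<lambda>k. \<Sum>i\<le>n. cmod (coeff (P k) i - coeff P' i) * R ^ i) \<longlongrightarrow> 0) G"
    by simp
  then have "\<forall>\<^sub>F k in G. (\<Sum>i\<le>n. cmod (coeff (P k) i - coeff P' i) * R ^ i) < e"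
    using \<open>e > 0\<close> by (rule order_tendstoD)
  then show "\<forall>\<^sub>F k in G. \<forall>z\<in>K. dist (poly (P k) z) (poly P' z) < e"
  proof eventually_elim
    case (elim k)
    show ?case
    proof
      fix z assume z: "z \<in> K"
      have "dist (poly (P k) z) (poly P' z) = cmod (\<Sum>i\<le>n. (coeff (P k) i - coeff P' i) * z ^ i)"
        unfolding dist_norm poly[OF assms(2)] poly[OF assms(3)] by (simp add: sum_subtractf left_diff_distrib)
      also have "\<dots> \<le> (\<Sum>i\<le>n. cmod (coeff (P k) i - coeff P' i) * R ^ i)"
        using R[OF z] by (intro sum_norm_le) (auto simp: norm_mult norm_power intro!: mult_left_mono power_mono)
      finally show "dist (poly (P k) z) (poly P' z) < e"
        using elim by simp
    qed
  qed
qed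

text \<open>On a compact neighbourhood \<open>L\<close> of \<open>K\<close> the limit denominator is
  bounded away from 0, so the quotients converge uniformly on \<open>L\<close>; Cauchy's estimate on
  discs inside \<open>L\<close> passes this on to the derivatives on \<open>K\<close>.\<close>

lemma rational_uniform_limit:
  fixes P Q :: "'b \<Rightarrow> complex poly"
  assumes P: "\<And>i. ((\<lambda>k. coeff (P k) i) \<longlongrightarrow> coeff P' i) G" "\<And>k. degree (P k) \<le> n" "degree P' \<le> n"
    and Q: "\<And>i. ((\<lambda>k. coeff (Q k) i) \<longlongrightarrow> coeff Q' i) G" "\<And>k. degree (Q k) \<le> n" "degree Q' \<le> n"
    and K: "compact K" "\<And>z. z \<in> K \<Longrightarrow> poly Q' z \<noteq> 0"
  shows "\<forall>\<^sub>F k in G. \<forall>z\<in>K. poly (Q k) z \<noteq> 0"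
    and "uniform_limit K (\<lambda>k. (deriv ^^ l) (\<lambda>z. poly (P k) z / poly (Q k) z))
      ((deriv ^^ l) (\<lambda>z. poly P' z / poly Q' z)) G"
proof -
  have "(\<forall>\<^sub>F k in G. \<forall>z\<in>K. poly (Q k) z \<noteq> 0) \<and>
    uniform_limit K (\<lambda>k. (deriv ^^ l) (\<lambda>z. poly (P k) z / poly (Q k) z))
      ((deriv ^^ l) (\<lambda>z. poly P' z / poly Q' z)) G"
  proof (cases "K = {}")
    case False
    have "open {z. poly Q' z \<noteq> 0}"
      by (intro open_Collect_neq continuous_intros)
    then obtain r where r: "r > 0" "(\<Union>z\<in>K. cball z r) \<subseteq> {z. poly Q' z \<noteq> 0}"
      by (rule compact_subset_open_imp_cball_epsilon_subset[OF K(1)]) (use K(2) in auto)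
    define L where "L = {w. infdist w K \<le> r}"
    have L: "compact L"
      unfolding L_def using K(1) False r(1) by (intro compact_infdist_le)
    have KL: "ball z r \<subseteq> L" if "z \<in> K" for z
      using infdist_le2[OF that] unfolding L_def by (auto simp: dist_commute intro: less_imp_le)
    have nz: "poly Q' w \<noteq> 0" if w: "w \<in> L" for w
    proof -
      obtain z where "z \<in> K" "infdist w K = dist w z"
        using infdist_attains_inf[OF compact_imp_closed[OF K(1)] False, of w] by metis
      then have "w \<in> (\<Union>z\<in>K. cball z r)"
        using w unfolding L_def by (auto simp: dist_commute)
      then show ?thesis
        using r(2) by blast
    qed
    have "L \<noteq> {}"
      using False KL r(1) by (metis centre_in_ball empty_iff equals0I subset_empty)
    then obtain w0 where w0: "w0 \<in> L" "\<And>w. w \<in> L \<Longrightarrow> cmod (poly Q' w0) \<le> cmod (poly Q' w)"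
    proof -
      have "continuous_on L (\<lambda>w. cmod (poly Q' w))"
        by (intro continuous_intros)
      from continuous_attains_inf[OF L \<open>L \<noteq> {}\<close> this] show ?thesis
        using that by blast
    qed
    define b where "b = cmod (poly Q' w0)"
    have b: "b > 0" "\<And>w. w \<in> L \<Longrightarrow> b \<le> cmod (poly Q' w)"
      unfolding b_def using w0 nz by auto
    note limP = uniform_limit_poly[OF P compact_imp_bounded[OF L]]
    note limQ = uniform_limit_poly[OF Q compact_imp_bounded[OF L]]
    have ev: "\<forall>\<^sub>F k in G. \<forall>z\<in>L. poly (Q k) z \<noteq> 0"
      using uniform_limitD[OF limQ b(1)]
    proof eventually_elim
      case (elim k)
      then show ?case
        using b(2) by (fastforce simp: dist_norm)
    qed
    have "bounded (poly P' ` L)"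
      by (intro compact_imp_bounded compact_continuous_image L continuous_intros)
    then have lim: "uniform_limit L (\<lambda>k z. poly (P k) z / poly (Q k) z) (\<lambda>z. poly P' z / poly Q' z) G"
      by (rule uniform_lim_divide[OF limP limQ _ b(2,1)])
    have "uniform_limit K (\<lambda>k. (deriv ^^ l) (\<lambda>z. poly (P k) z / poly (Q k) z))
      ((deriv ^^ l) (\<lambda>z. poly P' z / poly Q' z)) G"
    proof (rule uniform_limitI)
      fix e :: real assume "e > 0"
      \<comment> \<open>Chosen so that the bound of \<open>higher_deriv_diff_bound\<close> equals
        \<open>e / 2\<close>.\<close>
      define B where "B = e / 2 * (r / 2) ^ l / fact l"
      have B: "B > 0" "fact l * B / (r / 2) ^ l < e"
        unfolding B_def using \<open>e > 0\<close> r(1) by simp_all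
      show "\<forall>\<^sub>F k in G. \<forall>z\<in>K. dist ((deriv ^^ l) (\<lambda>z. poly (P k) z / poly (Q k) z) z)
          ((deriv ^^ l) (\<lambda>z. poly P' z / poly Q' z) z) < e"
        using uniform_limitD[OF lim B(1)] ev
      proof eventually_elim
        case (elim k)
        show ?case
        proof
          fix z assume z: "z \<in> K"
          have "cmod ((deriv ^^ l) (\<lambda>z. poly (P k) z / poly (Q k) z) z - (deriv ^^ l) (\<lambda>z. poly P' z / poly Q' z) z)
              \<le> fact l * B / (r / 2) ^ l"
          proof (rule higher_deriv_diff_bound)
            show "(\<lambda>z. poly (P k) z / poly (Q k) z) holomorphic_on ball z r"
              "(\<lambda>z. poly P' z / poly Q' z) holomorphic_on ball z r"
              using elim(2) KL[OF z] nz by (auto intro!: holomorphic_intros)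
          qed (use r(1) elim(1) KL[OF z] in \<open>auto simp: dist_norm\<close>)
          then show "dist ((deriv ^^ l) (\<lambda>z. poly (P k) z / poly (Q k) z) z)
              ((deriv ^^ l) (\<lambda>z. poly P' z / poly Q' z) z) < e"
            using B(2) by (simp add: dist_norm)
        qed
      qed
    qed
    moreover have "K \<subseteq> L"
      using KL r(1) by force
    then have "\<forall>\<^sub>F k in G. \<forall>z\<in>K. poly (Q k) z \<noteq> 0"
      by (intro eventually_mono[OF ev]) auto
    ultimately show ?thesis
      by blast
  qed simp
  then show "\<forall>\<^sub>F k in G. \<forall>z\<in>K. poly (Q k) z \<noteq> 0"
    "uniform_limit K (\<lambda>k. (deriv ^^ l) (\<lambda>z. poly (P k) z / poly (Q k) z))
      ((deriv ^^ l) (\<lambda>z. poly P' z / poly Q' z)) G"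
    by blast+
qed

section \<open>The metric\<close>

lemma restrict_in_A_infty:
  assumes "open \<Omega>" "open U" "closure \<Omega> \<subseteq> U" "h holomorphic_on U"
  shows "restrict h \<Omega> \<in> A_infty \<Omega>"
    and "z \<in> closure \<Omega> \<Longrightarrow> A_infty_deriv \<Omega> l (restrict h \<Omega>) z = (deriv ^^ l) h z"
proof -
  have eq: "(deriv ^^ l) h z = (deriv ^^ l) (restrict h \<Omega>) z" if "z \<in> \<Omega>" for l z
    using eventually_nhds_in_open[OF assms(1) that]
    by (intro higher_deriv_cong_ev refl) (auto elim!: eventually_mono)
  have cont: "continuous_on (closure \<Omega>) ((deriv ^^ l) h)" for l
    using holomorphic_higher_deriv[OF assms(4,2), of l] assms(3)
    by (meson continuous_on_subset holomorphic_on_imp_continuous_on)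
  have "h holomorphic_on \<Omega>"
    using assms(3,4) closure_subset by (blast intro: holomorphic_on_subset)
  then have "restrict h \<Omega> holomorphic_on \<Omega>"
    by (rule holomorphic_transform) simp
  then show "restrict h \<Omega> \<in> A_infty \<Omega>"
    unfolding A_infty_def using cont eq by (auto intro!: exI[of _ "(deriv ^^ _) h"])
  show "A_infty_deriv \<Omega> l (restrict h \<Omega>) z = (deriv ^^ l) h z" if "z \<in> closure \<Omega>"
    by (rule A_infty_deriv_unique[OF assms(1) cont eq that])
qed

lemma H_closure_subset_A_infty: "open \<Omega> \<Longrightarrow> H_closure \<Omega> \<subseteq> A_infty \<Omega>"
  unfolding H_closure_def using restrict_in_A_infty(1) by blast

definition A_infty_rho_term ::
    "complex set \<Rightarrow> (complex \<Rightarrow> complex) \<Rightarrow> (complex \<Rightarrow> complex) \<Rightarrow> nat \<Rightarrow> nat \<Rightarrow> real" where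
  "A_infty_rho_term \<Omega> f g l n = (1/2) ^ (l + Suc n) * min (A_infty_dist_ln \<Omega> l (Suc n) f g) 1"

context
  fixes \<Omega> :: "complex set"
  assumes \<Omega>: "open \<Omega>" "0 \<in> \<Omega>"
begin

lemma A_infty_rho_summands:
  assumes "f \<in> A_infty \<Omega>" "g \<in> A_infty \<Omega>"
  defines "T \<equiv> A_infty_rho_term \<Omega> f g"
  shows "0 \<le> T l n" "T l n \<le> (1/2) ^ (l + Suc n)" "summable (T l)" "0 \<le> suminf (T l)" "suminf (T l) \<le> (1/2) ^ l"
    "summable (\<lambda>l. suminf (T l))" "A_infty_rho \<Omega> f g = (\<Sum>l. suminf (T l))"
proof -
  have T: "0 \<le> T l n" "T l n \<le> (1/2) ^ (l + Suc n)" for l n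
    unfolding T_def A_infty_rho_term_def using A_infty_dist_ln_nonneg[OF \<Omega> assms(1,2)]
    by (simp_all add: mult_left_le)
  then show "0 \<le> T l n" "T l n \<le> (1/2) ^ (l + Suc n)"
    by blast+
  have geom: "(\<lambda>n. (1/2::real) ^ (l + Suc n)) sums (1/2) ^ l" for l
    using sums_mult[OF power_half_series, of "(1/2) ^ l"] by (simp add: power_add)
  have sT: "summable (T l)" for l
    using T(2)[of l] by (intro summable_comparison_test'[OF sums_summable[OF geom[of l]], of 0])
      (simp add: abs_of_nonneg[OF T(1)])
  then show "summable (T l)" .
  have s: "0 \<le> suminf (T l)" "suminf (T l) \<le> (1/2) ^ l" for l
  proof -
    show "0 \<le> suminf (T l)"
      by (rule suminf_nonneg[OF sT T(1)])
    have "suminf (T l) \<le> (\<Sum>n. (1/2::real) ^ (l + Suc n))"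
      by (rule suminf_le[OF T(2) sT sums_summable[OF geom]])
    then show "suminf (T l) \<le> (1/2) ^ l"
      using sums_unique[OF geom[of l]] by simp
  qed
  then show "0 \<le> suminf (T l)" "suminf (T l) \<le> (1/2) ^ l"
    by blast+
  show "summable (\<lambda>l. suminf (T l))"
  proof (rule summable_comparison_test'[of "\<lambda>l. (1/2::real) ^ l" 0])
    show "summable (\<lambda>l. (1/2::real) ^ l)"
      by (rule summable_geometric) simp
    show "norm (suminf (T l)) \<le> (1/2) ^ l" for l
      using s[of l] by (simp only: real_norm_def abs_of_nonneg)
  qed
  show "A_infty_rho \<Omega> f g = (\<Sum>l. suminf (T l))"
    unfolding A_infty_rho_def T_def A_infty_rho_term_def using assms(1,2) by (simp only: if_True simp_thms)
qed

text \<open>A single term is at most the sum of a series of nonnegative terms; the power of 2 undoes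
  its weight.\<close>

lemma A_infty_dist_ln_le_rho:
  assumes "f \<in> A_infty \<Omega>" "g \<in> A_infty \<Omega>"
  shows "min (A_infty_dist_ln \<Omega> l (Suc n) f g) 1 \<le> 2 ^ (l + Suc n) * A_infty_rho \<Omega> f g"
proof -
  define T where "T = A_infty_rho_term \<Omega> f g"
  note T = A_infty_rho_summands[OF assms, folded T_def]
  have "T l n \<le> suminf (T l)"
    using sum_le_suminf[OF T(3), of "{n}" l] T(1) by simp
  also have "\<dots> \<le> A_infty_rho \<Omega> f g"
    using sum_le_suminf[OF T(6), of "{l}"] T(4,7) by simp
  finally show ?thesis
    unfolding T_def A_infty_rho_term_def by (simp add: power_one_over field_simps)
qed

lemma A_infty_dist_ln_tendsto_0:
  assumes "f \<in> A_infty \<Omega>" "\<And>k. g k \<in> A_infty \<Omega>" "((\<lambda>k. A_infty_rho \<Omega> f (g k)) \<longlongrightarrow> 0) G"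
  shows "((\<lambda>k. A_infty_dist_ln \<Omega> l (Suc n) f (g k)) \<longlongrightarrow> 0) G"
proof (rule tendstoI)
  fix e :: real assume "e > 0"
  \<comment> \<open>Compared with \<open>min e 1\<close> below, since only under 1 does the
    truncated distance coincide with the distance.\<close>
  have "((\<lambda>k. 2 ^ (l + Suc n) * A_infty_rho \<Omega> f (g k)) \<longlongrightarrow> 2 ^ (l + Suc n) * 0) G"
    by (intro tendsto_intros assms(3))
  then have "\<forall>\<^sub>F k in G. 2 ^ (l + Suc n) * A_infty_rho \<Omega> f (g k) < min e 1"
    using \<open>e > 0\<close> by (intro order_tendstoD) auto
  then show "\<forall>\<^sub>F k in G. dist (A_infty_dist_ln \<Omega> l (Suc n) f (g k)) 0 < e"
  proof eventually_elim
    case (elim k)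
    then show ?case
      using A_infty_dist_ln_le_rho[OF assms(1,2), of l n k] A_infty_dist_ln_nonneg[OF \<Omega> assms(1,2), of l "Suc n" k]
      by (simp add: min_def split: if_splits)
  qed
qed

text \<open>Tannery's theorem, dominated convergence for series, first for the sum over
  \<open>n\<close> and then for the sum over \<open>l\<close>, with geometric majorants.\<close>

lemma A_infty_rho_tendsto_0:
  assumes "f \<in> A_infty \<Omega>" "\<And>k. g k \<in> A_infty \<Omega>"
    and "\<And>l n. (\<lambda>k. A_infty_dist_ln \<Omega> l (Suc n) f (g k)) \<longlonglongrightarrow> 0"
  shows "(\<lambda>k. A_infty_rho \<Omega> f (g k)) \<longlonglongrightarrow> 0"
proof -
  define T where "T = (\<lambda>k. A_infty_rho_term \<Omega> f (g k))"
  have T_app: "A_infty_rho_term \<Omega> f (g k) = T k" for k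
    unfolding T_def ..
  note T = A_infty_rho_summands[OF assms(1,2), unfolded T_app]
  have T0: "(\<lambda>k. T k l n) \<longlonglongrightarrow> 0" for l n
  proof -
    have "(\<lambda>k. (1/2) ^ (l + Suc n) * min (A_infty_dist_ln \<Omega> l (Suc n) f (g k)) 1) \<longlonglongrightarrow> (1/2) ^ (l + Suc n) * min 0 1"
      by (intro tendsto_intros assms(3))
    then show ?thesis
      unfolding T_def A_infty_rho_term_def by simp
  qed
  have S0: "(\<lambda>k. suminf (T k l)) \<longlonglongrightarrow> 0" for l
  proof -
    have "\<forall>\<^sub>F (n, k) in at_top \<times>\<^sub>F sequentially. norm (T k l n) \<le> (1/2) ^ (l + Suc n)"
      using T(1,2) by (intro always_eventually) (auto simp: abs_of_nonneg)
    moreover have "summable (\<lambda>n. (1/2::real) ^ (l + Suc n))"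
      using summable_mult[OF sums_summable[OF power_half_series], of "(1/2) ^ l"] by (simp add: power_add)
    ultimately have "(\<lambda>k. suminf (T k l)) \<longlonglongrightarrow> (\<Sum>n. 0)"
      using tannerys_theorem[of "\<lambda>n k. T k l n" "\<lambda>n. 0" sequentially "\<lambda>n. (1/2::real) ^ (l + Suc n)"] T0
      by simp
    then show ?thesis
      by simp
  qed
  have "\<forall>\<^sub>F (l, k) in at_top \<times>\<^sub>F sequentially. norm (suminf (T k l)) \<le> (1/2) ^ l"
    using T(4,5) by (intro always_eventually) (auto simp: abs_of_nonneg)
  moreover have "summable (\<lambda>l. (1/2::real) ^ l)"
    by (rule summable_geometric) simp
  ultimately have "(\<lambda>k. \<Sum>l. suminf (T k l)) \<longlonglongrightarrow> (\<Sum>l. 0)"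
    using tannerys_theorem[of "\<lambda>l k. suminf (T k l)" "\<lambda>l. 0" sequentially "\<lambda>l. (1/2::real) ^ l"] S0
    by simp
  then show ?thesis
    unfolding T(7) by simp
qed

end

section \<open>The set is a countable intersection of open sets\<close>

lemma fps_expansion_A_infty:
  assumes "open \<Omega>" "0 \<in> \<Omega>" "f \<in> A_infty \<Omega>"
  shows "fps_expansion f 0 $ v = A_infty_deriv \<Omega> v f 0 / fact v"
  using A_infty_deriv_eq[OF assms(1,3,2)] by (simp add: fps_expansion_def)

text \<open>A single \<open>M\<close> controls the radius, the order of the derivatives and the
  error. The uniform bound \<open>e\<close> strictly below \<open>1 / (M + 1)\<close>, in place of a
  pointwise strict inequality, leaves room for perturbations and makes the set open.\<close>

definition pade_near :: "complex set \<Rightarrow> nat \<Rightarrow> nat \<Rightarrow> nat \<Rightarrow> (complex \<Rightarrow> complex) set" where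
  "pade_near \<Omega> M p q = {f \<in> A_infty \<Omega>. f \<in> pade_D p q \<and>
     (\<forall>z \<in> closure \<Omega> \<inter> cball 0 (real M). \<not> is_pole (pade p q f) z) \<and>
     (\<exists>e < 1 / real (Suc M). \<forall>l\<le>M. \<forall>z \<in> closure \<Omega> \<inter> cball 0 (real M).
        cmod ((deriv ^^ l) (pade p q f) z - A_infty_deriv \<Omega> l f z) \<le> e)}"

context
  fixes \<Omega> :: "complex set"
  assumes \<Omega>: "open \<Omega>" "0 \<in> \<Omega>"
begin

interpretation A: Metric_space "A_infty \<Omega>" "A_infty_rho \<Omega>"
  by (rule Metric_space_A_infty[OF \<Omega>])

lemma uniform_limit_A_infty_deriv:
  assumes "f \<in> A_infty \<Omega>" "\<And>k. g k \<in> A_infty \<Omega>" "((\<lambda>k. A_infty_rho \<Omega> f (g k)) \<longlongrightarrow> 0) G"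
  shows "uniform_limit (closure \<Omega> \<inter> cball 0 (real M)) (\<lambda>k. A_infty_deriv \<Omega> l (g k)) (A_infty_deriv \<Omega> l f) G"
proof (rule uniform_limitI)
  fix e :: real assume "e > 0"
  then have "\<forall>\<^sub>F k in G. A_infty_dist_ln \<Omega> l (Suc M) f (g k) < e"
    using order_tendstoD(2)[OF A_infty_dist_ln_tendsto_0[OF \<Omega> assms]] by blast
  then show "\<forall>\<^sub>F k in G. \<forall>z\<in>closure \<Omega> \<inter> cball 0 (real M). dist (A_infty_deriv \<Omega> l (g k) z) (A_infty_deriv \<Omega> l f z) < e"
  proof eventually_elim
    case (elim k)
    show ?case
    proof
      fix z assume "z \<in> closure \<Omega> \<inter> cball 0 (real M)"
      then have "cmod (A_infty_deriv \<Omega> l f z - A_infty_deriv \<Omega> l (g k) z) \<le> A_infty_dist_ln \<Omega> l (Suc M) f (g k)"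
        by (intro A_infty_dist_ln_upper[OF \<Omega>(1) assms(1,2)]) auto
      then show "dist (A_infty_deriv \<Omega> l (g k) z) (A_infty_deriv \<Omega> l f z) < e"
        using elim by (simp add: dist_norm norm_minus_commute)
    qed
  qed
qed

lemma eventually_in_pade_near:
  assumes f: "f \<in> pade_near \<Omega> M p q" and g: "\<And>k. g k \<in> A_infty \<Omega>"
    and lim: "((\<lambda>k. A_infty_rho \<Omega> f (g k)) \<longlongrightarrow> 0) G"
  shows "\<forall>\<^sub>F k in G. g k \<in> pade_near \<Omega> M p q"
proof -
  define K where "K = closure \<Omega> \<inter> cball 0 (real M)"
  have K: "compact K"
    unfolding K_def by (rule closed_Int_compact) auto
  have fA: "f \<in> A_infty \<Omega>" and fD: "f \<in> pade_D p q"
    using f unfolding pade_near_def by blast+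
  have den: "poly (pade_den p q f) z \<noteq> 0" if "z \<in> K" for z
    using f that not_is_pole_pade_iff[OF fD] unfolding pade_near_def K_def by blast
  obtain e where e: "e < 1 / real (Suc M)"
    "\<And>l z. l \<le> M \<Longrightarrow> z \<in> K \<Longrightarrow> cmod ((deriv ^^ l) (pade p q f) z - A_infty_deriv \<Omega> l f z) \<le> e"
    using f unfolding pade_near_def K_def by blast
  \<comment> \<open>When \<open>f\<close> is perturbed, both the function and its approximant move,
    each by less than \<open>d\<close>; together they fit into the gap above
    \<open>e\<close>.\<close>
  obtain d where d: "d > 0" "e + 2 * d < 1 / real (Suc M)"
  proof -
    define u where "u = 1 / real (Suc M)"
    have "(u - e) / 3 > 0" "e + 2 * ((u - e) / 3) < u"
      using e(1) unfolding u_def[symmetric] by (simp_all add: field_simps)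
    then show ?thesis
      using that unfolding u_def by blast
  qed
  note unif = uniform_limit_A_infty_deriv[OF fA g lim]
  \<comment> \<open>Radius 0 suffices, since Taylor coefficients are derivatives at 0 divided by
    factorials.\<close>
  have coeffs: "((\<lambda>k. fps_expansion (g k) 0 $ v) \<longlongrightarrow> fps_expansion f 0 $ v) G" for v
    unfolding fps_expansion_A_infty[OF \<Omega> fA] fps_expansion_A_infty[OF \<Omega> g]
    using \<Omega>(2) closure_subset
    by (intro tendsto_divide tendsto_const tendsto_uniform_limitI[OF unif[where M = 0 and l = v]]) auto
  note N = tendsto_coeff_pade_num[of g f G p q, OF coeffs fD]
  note D = tendsto_coeff_pade_den[of g f G p q, OF coeffs fD]
  have deg: "degree (pade_num p q h) \<le> p + q" "degree (pade_den p q h) \<le> p + q" for h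
    using degree_pade_num[of p q h] degree_pade_den[of p q h] by linarith+
  have ev1: "\<forall>\<^sub>F k in G. g k \<in> pade_D p q"
    by (rule eventually_in_pade_D[of g f G p q, OF coeffs fD])
  have ev2: "\<forall>\<^sub>F k in G. \<forall>z\<in>K. poly (pade_den p q (g k)) z \<noteq> 0"
    by (rule rational_uniform_limit(1)[OF N deg(1) deg(1) D deg(2) deg(2) K den])
  have ev3: "\<forall>\<^sub>F k in G. \<forall>l\<in>{..M}. \<forall>z\<in>K. dist ((deriv ^^ l) (\<lambda>z. poly (pade_num p q (g k)) z / poly (pade_den p q (g k)) z) z)
      ((deriv ^^ l) (\<lambda>z. poly (pade_num p q f) z / poly (pade_den p q f) z) z) < d"
    by (intro eventually_ball_finite ballI finite_atMost uniform_limitD[OF _ d(1)]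
        rational_uniform_limit(2)[OF N deg(1) deg(1) D deg(2) deg(2) K den])
  have ev4: "\<forall>\<^sub>F k in G. \<forall>l\<in>{..M}. \<forall>z\<in>K. dist (A_infty_deriv \<Omega> l (g k) z) (A_infty_deriv \<Omega> l f z) < d"
    unfolding K_def by (intro eventually_ball_finite ballI finite_atMost uniform_limitD[OF unif d(1)])
  show ?thesis
    using ev1 ev2 ev3 ev4
  proof eventually_elim
    case (elim k)
    have "cmod ((deriv ^^ l) (pade p q (g k)) z - A_infty_deriv \<Omega> l (g k) z) \<le> e + 2 * d" if "l \<le> M" "z \<in> K" for l z
    proof -
      have "dist ((deriv ^^ l) (pade p q (g k)) z) ((deriv ^^ l) (pade p q f) z) < d"
        using elim(2,3) that den[OF that(2)] by (simp add: higher_deriv_pade[OF elim(1)] higher_deriv_pade[OF fD])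
      moreover have "dist (A_infty_deriv \<Omega> l (g k) z) (A_infty_deriv \<Omega> l f z) < d"
        using elim(4) that by simp
      moreover have "dist ((deriv ^^ l) (pade p q f) z) (A_infty_deriv \<Omega> l f z) \<le> e"
        using e(2)[OF that] by (simp add: dist_norm)
      ultimately show ?thesis
        using dist_triangle[of "(deriv ^^ l) (pade p q (g k)) z" "A_infty_deriv \<Omega> l (g k) z" "(deriv ^^ l) (pade p q f) z"]
          dist_triangle[of "(deriv ^^ l) (pade p q f) z" "A_infty_deriv \<Omega> l (g k) z" "A_infty_deriv \<Omega> l f z"]
        unfolding dist_norm[symmetric] by (simp add: dist_commute)
    qed
    then show ?case
      using elim(1,2) d(2) g not_is_pole_pade_iff[OF elim(1)] unfolding pade_near_def K_def by blast
  qed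
qed

text \<open>If no ball around \<open>f\<close> fitted, points outside the set taken from balls of
  radius \<open>1 / (k + 1)\<close> would form a sequence converging to \<open>f\<close>, against
  \<open>eventually_in_pade_near\<close>.\<close>

lemma openin_pade_near: "openin (A_infty_topology \<Omega>) (pade_near \<Omega> M p q)"
  unfolding A_infty_topology_def A.openin_mtopology
proof (intro conjI allI impI)
  show "pade_near \<Omega> M p q \<subseteq> A_infty \<Omega>"
    unfolding pade_near_def by blast
  fix f assume f: "f \<in> pade_near \<Omega> M p q"
  show "\<exists>r>0. A.mball f r \<subseteq> pade_near \<Omega> M p q"
  proof (rule ccontr)
    assume neg: "\<not> (\<exists>r>0. A.mball f r \<subseteq> pade_near \<Omega> M p q)"
    have "\<exists>g. g \<in> A.mball f (inverse (real (Suc k))) \<and> g \<notin> pade_near \<Omega> M p q" for k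
      using neg by (metis inverse_positive_iff_positive of_nat_0_less_iff subsetI zero_less_Suc)
    then obtain g where g: "\<And>k. g k \<in> A.mball f (inverse (real (Suc k)))" "\<And>k. g k \<notin> pade_near \<Omega> M p q"
      by metis
    have "(\<lambda>k. A_infty_rho \<Omega> f (g k)) \<longlonglongrightarrow> 0"
    proof (rule tendsto_sandwich[OF _ _ tendsto_const LIMSEQ_inverse_real_of_nat])
      show "\<forall>\<^sub>F k in sequentially. A_infty_rho \<Omega> f (g k) \<le> inverse (real (Suc k))"
        using g(1) by (intro always_eventually allI less_imp_le) (auto simp: A.in_mball)
    qed auto
    then have "\<forall>\<^sub>F k in sequentially. g k \<in> pade_near \<Omega> M p q"
      using g(1) by (intro eventually_in_pade_near[OF f]) (auto simp: A.in_mball)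
    then show False
      using g(2) by simp
  qed
qed

text \<open>From left to right, some late member of the sequence serves for the given
  \<open>M\<close>. From right to left, a pair chosen for each \<open>M\<close> gives the sequence:
  \<open>K\<close> lies in the disc of radius \<open>m\<close> and \<open>l \<le> m\<close> for all
  large \<open>m\<close>, and the errors are below \<open>1 / (m + 1)\<close>.\<close>

lemma B_F_eq: "B_F \<Omega> F = (\<Inter>M. \<Union>(p, q)\<in>F. pade_near \<Omega> M p q)"
proof (intro equalityI subsetI)
  fix f assume "f \<in> B_F \<Omega> F"
  then have fA: "f \<in> A_infty \<Omega>" and ex: "\<exists>p q. (\<forall>m. (p m, q m) \<in> F \<and> f \<in> pade_D (p m) (q m)) \<and>
      (\<forall>K l. compact K \<and> K \<subseteq> closure \<Omega> \<longrightarrow>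
        uniform_limit_deriv K l (\<lambda>m :: nat. pade (p m) (q m) f) (A_infty_deriv \<Omega> l f))"
    unfolding B_F_def by simp_all
  obtain p q where pq: "\<forall>m. (p m, q m) \<in> F \<and> f \<in> pade_D (p m) (q m)"
    and conv: "\<forall>K l. compact K \<and> K \<subseteq> closure \<Omega> \<longrightarrow>
        uniform_limit_deriv K l (\<lambda>m :: nat. pade (p m) (q m) f) (A_infty_deriv \<Omega> l f)"
    using ex by (elim exE conjE)
  note f = fA pq[THEN spec, THEN conjunct1] pq[THEN spec, THEN conjunct2]
  have lim: "uniform_limit_deriv K l (\<lambda>m. pade (p m) (q m) f) (A_infty_deriv \<Omega> l f)"
    if "compact K" "K \<subseteq> closure \<Omega>" for K l
    using conv that by simp
  show "f \<in> (\<Inter>M. \<Union>(p, q)\<in>F. pade_near \<Omega> M p q)"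
  proof
    fix M :: nat
    define K where "K = closure \<Omega> \<inter> cball 0 (real M)"
    have K: "compact K" "K \<subseteq> closure \<Omega>"
      unfolding K_def by (auto intro: closed_Int_compact)
    define e where "e = 1 / (2 * real (Suc M))"
    have e: "e > 0" "e < 1 / real (Suc M)"
      unfolding e_def by (simp_all add: field_simps)
    have "\<forall>\<^sub>F m in sequentially. \<forall>z\<in>K. \<not> is_pole (pade (p m) (q m) f) z"
      using lim[OF K, of 0] unfolding uniform_limit_deriv_def by blast
    moreover have "\<forall>\<^sub>F m in sequentially. \<forall>l\<in>{..M}. \<forall>z\<in>K.
        dist ((deriv ^^ l) (pade (p m) (q m) f) z) (A_infty_deriv \<Omega> l f z) < e"
      using lim[OF K] unfolding uniform_limit_deriv_def
      by (intro eventually_ball_finite ballI finite_atMost uniform_limitD[OF _ e(1)]) blast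
    ultimately have "\<forall>\<^sub>F m in sequentially. f \<in> pade_near \<Omega> M (p m) (q m)"
    proof eventually_elim
      case (elim m)
      then have "\<exists>e < 1 / real (Suc M). \<forall>l\<le>M. \<forall>z\<in>K.
          cmod ((deriv ^^ l) (pade (p m) (q m) f) z - A_infty_deriv \<Omega> l f z) \<le> e"
        using e(2) by (intro exI[of _ e]) (simp add: dist_norm less_imp_le)
      then show ?case
        using f(1,3) elim(1) unfolding pade_near_def K_def[symmetric] by simp
    qed
    then obtain m where "f \<in> pade_near \<Omega> M (p m) (q m)"
      using eventually_happens'[OF sequentially_bot] by blast
    then show "f \<in> (\<Union>(p, q)\<in>F. pade_near \<Omega> M p q)"
      using f(2) by blast
  qed
next
  fix f assume f: "f \<in> (\<Inter>M. \<Union>(p, q)\<in>F. pade_near \<Omega> M p q)"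
  then have "\<forall>M. \<exists>p q. (p, q) \<in> F \<and> f \<in> pade_near \<Omega> M p q"
    by blast
  then obtain p q where pq: "\<And>M. (p M, q M) \<in> F" "\<And>M. f \<in> pade_near \<Omega> M (p M) (q M)"
    by metis
  have "uniform_limit_deriv K l (\<lambda>m. pade (p m) (q m) f) (A_infty_deriv \<Omega> l f)"
    if K: "compact K" "K \<subseteq> closure \<Omega>" for K l
  proof -
    obtain R where R: "\<And>z. z \<in> K \<Longrightarrow> cmod z \<le> R"
      using compact_imp_bounded[OF K(1)] by (auto simp: bounded_iff)
    obtain n where n: "R \<le> real n"
      using real_arch_simple by blast
    have sub: "K \<subseteq> closure \<Omega> \<inter> cball 0 (real m)" if "m \<ge> n" for m
    proof
      fix z assume z: "z \<in> K"
      have "cmod z \<le> real m"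
        using R[OF z] n that by linarith
      then show "z \<in> closure \<Omega> \<inter> cball 0 (real m)"
        using K(2) z by auto
    qed
    have "\<forall>\<^sub>F m in sequentially. \<forall>z\<in>K. \<not> is_pole (pade (p m) (q m) f) z"
      using eventually_ge_at_top[of n]
    proof eventually_elim
      case (elim m)
      then show ?case
        using pq(2)[of m] sub[OF elim] unfolding pade_near_def by blast
    qed
    moreover have "uniform_limit K (\<lambda>m. (deriv ^^ l) (pade (p m) (q m) f)) (A_infty_deriv \<Omega> l f) sequentially"
    proof (rule uniform_limitI)
      fix e :: real assume "e > 0"
      then have "\<forall>\<^sub>F m in sequentially. inverse (real (Suc m)) < e"
        by (rule order_tendstoD(2)[OF LIMSEQ_inverse_real_of_nat])
      then show "\<forall>\<^sub>F m in sequentially. \<forall>z\<in>K. dist ((deriv ^^ l) (pade (p m) (q m) f) z) (A_infty_deriv \<Omega> l f z) < e"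
        using eventually_ge_at_top[of "max n l"]
      proof eventually_elim
        case (elim m)
        obtain d where d: "d < 1 / real (Suc m)" "\<And>z. z \<in> closure \<Omega> \<inter> cball 0 (real m) \<Longrightarrow>
            cmod ((deriv ^^ l) (pade (p m) (q m) f) z - A_infty_deriv \<Omega> l f z) \<le> d"
          using pq(2)[of m] elim(2) unfolding pade_near_def by auto
        show ?case
        proof
          fix z assume "z \<in> K"
          then have "cmod ((deriv ^^ l) (pade (p m) (q m) f) z - A_infty_deriv \<Omega> l f z) \<le> d"
            using sub[of m] elim(2) by (intro d(2)) auto
          then show "dist ((deriv ^^ l) (pade (p m) (q m) f) z) (A_infty_deriv \<Omega> l f z) < e"
            using d(1) elim(1) by (simp add: dist_norm inverse_eq_divide)
        qed
      qed
    qed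
    ultimately show ?thesis
      unfolding uniform_limit_deriv_def by blast
  qed
  moreover have "f \<in> A_infty \<Omega>" "\<And>m. f \<in> pade_D (p m) (q m)"
    using pq(2) unfolding pade_near_def by blast+
  ultimately show "f \<in> B_F \<Omega> F"
    using pq(1) unfolding B_F_def by (intro CollectI conjI exI[of _ p] exI[of _ q]) simp_all
qed

lemma gdelta_in_B_F: "gdelta_in (A_infty_topology \<Omega>) (B_F \<Omega> F)"
  unfolding B_F_eq
proof (rule gdelta_in_Inter)
  fix S assume "S \<in> range (\<lambda>M. \<Union>(p, q)\<in>F. pade_near \<Omega> M p q)"
  then obtain M where "S = (\<Union>(p, q)\<in>F. pade_near \<Omega> M p q)"
    by blast
  then have "openin (A_infty_topology \<Omega>) S"
    using openin_pade_near by auto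
  then show "gdelta_in (A_infty_topology \<Omega>) S"
    by (rule open_imp_gdelta_in)
qed auto

end

section \<open>Density\<close>

text \<open>The quotient changes by \<open>c\<close> times a monomial, so no new poles arise. At a
  root of \<open>D\<close> the new numerator has the same value as \<open>N\<close>, so lowest terms
  persist. The degree hypothesis gives both \<open>degree D \<le> p\<close> and
  \<open>degree N < p\<close>.\<close>

lemma rational_perturbation:
  fixes N D :: "complex poly"
  assumes "\<And>z. poly N z = 0 \<Longrightarrow> poly D z \<noteq> 0" "degree N + degree D < p" "c \<noteq> 0" "D \<noteq> 0"
  defines "M \<equiv> N + Polynomial.smult c (monom 1 (p - degree D) * D)"
  shows "degree M = p" "\<And>z. poly M z = 0 \<Longrightarrow> poly D z \<noteq> 0"
proof -
  have "degree (Polynomial.smult c (monom 1 (p - degree D) * D)) = p"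
    using assms(2,3,4) by (simp add: degree_mult_eq degree_monom_eq)
  then show "degree M = p"
    unfolding M_def using assms(2) by (simp add: degree_add_eq_right)
  show "poly D z \<noteq> 0" if "poly M z = 0" for z
    using that assms(1)[of z] unfolding M_def by auto
qed

lemma rational_in_B_F:
  fixes N D :: "complex poly"
  assumes \<Omega>: "open \<Omega>" "0 \<in> \<Omega>" and "\<And>z. poly N z = 0 \<Longrightarrow> poly D z \<noteq> 0" "N \<noteq> 0" "coeff D 0 = 1"
    and D: "\<And>z. z \<in> closure \<Omega> \<Longrightarrow> poly D z \<noteq> 0" and F: "(degree N, q) \<in> F" "degree D \<le> q"
  shows "restrict (\<lambda>z. poly N z / poly D z) \<Omega> \<in> B_F \<Omega> F \<inter> H_closure \<Omega>"
proof -
  define h where "h = (\<lambda>z. poly N z / poly D z)"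
  define f where "f = restrict h \<Omega>"
  define U where "U = {z. poly D z \<noteq> 0}"
  have U: "open U" "closure \<Omega> \<subseteq> U" "h holomorphic_on U"
    unfolding U_def h_def using D by (auto intro!: open_Collect_neq continuous_intros holomorphic_intros)
  have fH: "f \<in> H_closure \<Omega>"
    unfolding f_def H_closure_def using U by blast
  note A = restrict_in_A_infty[OF \<Omega>(1) U, folded f_def]
  have "\<forall>\<^sub>F z in nhds 0. f z = h z"
    using eventually_nhds_in_open[OF \<Omega>] unfolding f_def by eventually_elim simp
  then have exp: "fps_of_poly D * fps_expansion f 0 = fps_of_poly N"
    using fps_expansion_rational[of D N] assms(5) fps_expansion_cong[of f h 0] unfolding h_def by simp
  have fD: "f \<in> pade_D (degree N) q"
    by (rule rational_in_pade_D[OF exp assms(3,4) refl F(2)])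
  have pade: "pade (degree N) q f = remove_sings h"
    unfolding h_def using exp F(2) assms(5) by (intro pade_eq) auto
  have an: "h analytic_on {z}" if "z \<in> closure \<Omega>" for z
    unfolding h_def by (rule analytic_at_rational[OF D[OF that]])
  have "uniform_limit_deriv K l (\<lambda>m. pade (degree N) q f) (A_infty_deriv \<Omega> l f)" if "K \<subseteq> closure \<Omega>" for K l
  proof -
    have "\<not> is_pole (remove_sings h) z" if "z \<in> closure \<Omega>" for z
      by (intro analytic_at_imp_no_pole remove_sings_analytic_on an[OF that])
    moreover have "(deriv ^^ l) (remove_sings h) z = A_infty_deriv \<Omega> l f z" if "z \<in> closure \<Omega>" for z
      unfolding A(2)[OF that] by (intro higher_deriv_cong_ev eventually_remove_sings_eq_nhds an[OF that] refl)
    ultimately show ?thesis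
      using that unfolding uniform_limit_deriv_def pade by (auto simp: uniform_limit_iff subset_iff)
  qed
  then have "\<exists>p q. (\<forall>m. (p m, q m) \<in> F \<and> f \<in> pade_D (p m) (q m)) \<and> (\<forall>K l. compact K \<and> K \<subseteq> closure \<Omega> \<longrightarrow>
      uniform_limit_deriv K l (\<lambda>m :: nat. pade (p m) (q m) f) (A_infty_deriv \<Omega> l f))"
    using F(1) fD by - (rule exI[of _ "\<lambda>_. degree N"], rule exI[of _ "\<lambda>_. q"], blast)
  then have "f \<in> B_F \<Omega> F"
    unfolding B_F_def using A(1) by blast
  then show ?thesis
    using fH unfolding f_def h_def by blast
qed

text \<open>Half of \<open>e\<close> is spent on Runge's theorem, the other half on correcting the
  degree of the numerator. As in \<open>pade_near\<close>, \<open>n\<close> bounds both the radius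
  and the order of the derivatives.\<close>

lemma H_closure_approx:
  assumes \<Omega>: "open \<Omega>" "0 \<in> \<Omega>"
    and F: "\<exists>p q :: nat \<Rightarrow> nat. (\<forall>m. (p m, q m) \<in> F) \<and>
      filterlim p at_top sequentially \<and> filterlim q at_top sequentially"
    and f: "f \<in> H_closure \<Omega>" and "e > 0"
  shows "\<exists>g \<in> B_F \<Omega> F \<inter> H_closure \<Omega>. \<forall>l\<le>n. A_infty_dist_ln \<Omega> l n f g \<le> e"
proof -
  define C where "C = closure \<Omega>"
  obtain h U where U: "open U" "C \<subseteq> U" "h holomorphic_on U" and f: "f = restrict h \<Omega>"
    using f unfolding H_closure_def C_def by blast
  have C: "closed C" "C \<noteq> {}" "0 \<in> C"
    using \<Omega>(2) closure_subset unfolding C_def by auto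
  obtain r where r: "r > 0" "(\<Union>z\<in>C \<inter> cball 0 (real n). ball z r) \<subseteq> U"
    "rational_approx (- (C \<union> (\<Union>z\<in>C \<inter> cball 0 (real n). ball z r))) (\<Union>z\<in>C \<inter> cball 0 (real n). ball z r) h"
    by (rule rational_approx_closed[OF C(1,2) U])
  \<comment> \<open>Dominates the constants of Cauchy's estimate for all orders up to
    \<open>n\<close>, so that one accuracy \<open>B\<close> serves them all.\<close>
  define s where "s = (\<Sum>l\<le>n. fact l / (r / 2) ^ l)"
  have s: "fact l / (r / 2) ^ l \<le> s" if "l \<le> n" for l
    unfolding s_def using that r(1) by (intro member_le_sum) auto
  have "s > 0"
    using s[of 0] by simp
  define B where "B = e / 2 / s"
  have B: "B > 0"
    unfolding B_def using \<open>e > 0\<close> \<open>s > 0\<close> by simp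
  have sB: "fact l * B / (r / 2) ^ l \<le> e / 2" if "l \<le> n" for l
    using mult_right_mono[OF s[OF that], of B] B \<open>s > 0\<close> unfolding B_def by (simp add: field_simps)
  obtain P Q where PQ: "\<And>z. poly Q z = 0 \<Longrightarrow> z \<in> - (C \<union> (\<Union>z\<in>C \<inter> cball 0 (real n). ball z r))"
    "\<And>z. z \<in> (\<Union>z\<in>C \<inter> cball 0 (real n). ball z r) \<Longrightarrow> cmod (h z - poly P z / poly Q z) < B"
    by (rule rational_approxD[OF r(3) B]) blast
  have "poly Q 0 \<noteq> 0"
    using PQ(1) C(3) by blast
  then have "Q \<noteq> 0"
    by auto
  obtain N0 D0 where ND0: "N0 * Q = P * D0" "D0 \<noteq> 0" "\<And>z. poly D0 z = 0 \<Longrightarrow> poly Q z = 0"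
    "\<And>z. poly N0 z = 0 \<Longrightarrow> poly D0 z \<noteq> 0"
    by (rule rational_lowest_terms[OF \<open>Q \<noteq> 0\<close>, of P]) blast
  \<comment> \<open>Normalises the denominator to \<open>D(0) = 1\<close>, as a Pade denominator
    requires.\<close>
  define a where "a = inverse (poly D0 0)"
  have a: "a \<noteq> 0" "a * poly D0 0 = 1"
    using ND0(3)[of 0] \<open>poly Q 0 \<noteq> 0\<close> unfolding a_def by (auto intro!: left_inverse)
  define N D where "N = Polynomial.smult a N0" and "D = Polynomial.smult a D0"
  have ND: "coeff D 0 = 1" "D \<noteq> 0" "\<And>z. poly N z = 0 \<Longrightarrow> poly D z \<noteq> 0"
    using a ND0(2,4) unfolding N_def D_def by (auto simp: poly_0_coeff_0)
  have DC: "poly D z \<noteq> 0" if "z \<in> C" for z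
    using ND0(3)[of z] PQ(1)[of z] that a(1) unfolding D_def by auto
  have quot: "poly P z / poly Q z = poly N z / poly D z" if "poly Q z \<noteq> 0" for z
  proof -
    have "poly N0 z * poly Q z = poly P z * poly D0 z"
      using ND0(1) by (metis poly_mult)
    moreover have "poly D0 z \<noteq> 0"
      using ND0(3) that by blast
    ultimately show ?thesis
      using that a(1) unfolding N_def D_def by (simp add: field_simps)
  qed
  obtain p q where pq: "(p, q) \<in> F" "degree N + degree D < p" "degree D \<le> q"
  proof -
    obtain p q :: "nat \<Rightarrow> nat" where F: "\<forall>m. (p m, q m) \<in> F"
      "filterlim p at_top sequentially" "filterlim q at_top sequentially"
      using F by blast
    have "\<forall>\<^sub>F m in sequentially. degree N + degree D < p m \<and> degree D \<le> q m"
      using F(2,3) unfolding filterlim_at_top Suc_le_eq[symmetric] by (simp add: eventually_conj)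
    then obtain m where "degree N + degree D < p m" "degree D \<le> q m"
      using eventually_happens'[OF sequentially_bot] by blast
    then show ?thesis
      using F(1) that by blast
  qed
  \<comment> \<open>The coefficients \<open>1 / (k + 1)\<close> tend to 0, so
    \<open>rational_uniform_limit\<close> handles all derivatives of the correction at once, while
    the degree stays \<open>p\<close> for every \<open>k\<close>.\<close>
  define M where "M = (\<lambda>k :: nat. N + Polynomial.smult (of_real (inverse (real (Suc k)))) (monom 1 (p - degree D) * D))"
  have M: "degree (M k) = p" "\<And>z. poly (M k) z = 0 \<Longrightarrow> poly D z \<noteq> 0" for k
    unfolding M_def
    using rational_perturbation[OF ND(3) pq(2), of "of_real (inverse (real (Suc k)))"] ND(2)
    by (simp_all del: of_nat_Suc)
  have "(\<lambda>k. coeff (M k) i) \<longlonglongrightarrow> coeff N i + of_real 0 * coeff (monom 1 (p - degree D) * D) i" for i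
    unfolding M_def coeff_add coeff_smult
    by (intro tendsto_add tendsto_mult tendsto_of_real tendsto_const LIMSEQ_inverse_real_of_nat)
  then have limM: "(\<lambda>k. coeff (M k) i) \<longlonglongrightarrow> coeff N i" for i
    by simp
  have K: "compact (C \<inter> cball 0 (real n))"
    by (rule closed_Int_compact[OF C(1) compact_cball])
  have "uniform_limit (C \<inter> cball 0 (real n)) (\<lambda>k. (deriv ^^ l) (\<lambda>z. poly (M k) z / poly D z))
      ((deriv ^^ l) (\<lambda>z. poly N z / poly D z)) sequentially" for l
    using pq(2) M(1) DC
    by (intro rational_uniform_limit(2)[of M N sequentially p "\<lambda>_. D" D] limM K tendsto_const) auto
  then have "\<forall>\<^sub>F k in sequentially. \<forall>l\<in>{..n}. \<forall>z\<in>C \<inter> cball 0 (real n).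
      dist ((deriv ^^ l) (\<lambda>z. poly (M k) z / poly D z) z) ((deriv ^^ l) (\<lambda>z. poly N z / poly D z) z) < e / 2"
    using \<open>e > 0\<close> by (intro eventually_ball_finite ballI finite_atMost uniform_limitD) auto
  then obtain k where k: "\<And>l z. l \<le> n \<Longrightarrow> z \<in> C \<inter> cball 0 (real n) \<Longrightarrow>
      dist ((deriv ^^ l) (\<lambda>z. poly (M k) z / poly D z) z) ((deriv ^^ l) (\<lambda>z. poly N z / poly D z) z) < e / 2"
    using eventually_happens'[OF sequentially_bot] by (metis (no_types, lifting) atMost_iff)
  define g where "g = (\<lambda>z. poly (M k) z / poly D z)"
  have "M k \<noteq> 0"
    using M(1)[of k] pq(2) by auto
  then have gB: "restrict g \<Omega> \<in> B_F \<Omega> F \<inter> H_closure \<Omega>"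
    unfolding g_def using M[of k] ND(1) DC pq(1,3) unfolding C_def
    by (intro rational_in_B_F[OF \<Omega>, where q = q]) auto
  have hol: "(\<lambda>z. poly R z / poly D z) holomorphic_on {z. poly D z \<noteq> 0}" for R
    by (intro holomorphic_intros) auto
  have op: "open {z. poly D z \<noteq> 0}"
    by (intro open_Collect_neq continuous_intros)
  have "A_infty_dist_ln \<Omega> l n f (restrict g \<Omega>) \<le> e" if l: "l \<le> n" for l
  proof (rule A_infty_dist_ln_least[OF \<Omega>(2)])
    fix z assume z: "z \<in> closure \<Omega>" "cmod z \<le> real n"
    then have zK: "z \<in> C \<inter> cball 0 (real n)"
      unfolding C_def by simp
    define W where "W = ball z r"
    have W: "W \<subseteq> (\<Union>z\<in>C \<inter> cball 0 (real n). ball z r)"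
      unfolding W_def using zK by blast
    have "A_infty_deriv \<Omega> l f z = (deriv ^^ l) h z"
      unfolding f using U z(1) by (intro restrict_in_A_infty(2)[OF \<Omega>(1)]) (auto simp: C_def)
    moreover have "A_infty_deriv \<Omega> l (restrict g \<Omega>) z = (deriv ^^ l) g z"
      unfolding g_def using op hol DC z(1)
      by (intro restrict_in_A_infty(2)[OF \<Omega>(1), of "{z. poly D z \<noteq> 0}"]) (auto simp: C_def)
    moreover have "cmod ((deriv ^^ l) h z - (deriv ^^ l) (\<lambda>z. poly N z / poly D z) z) \<le> e / 2"
    proof (rule order_trans[OF higher_deriv_diff_bound sB[OF l]])
      have Q: "poly Q w \<noteq> 0" if "w \<in> W" for w
        using PQ(1) W that by blast
      then have "poly D w \<noteq> 0" if "w \<in> W" for w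
        using ND0(3) a(1) that unfolding D_def by auto
      then show "(\<lambda>z. poly N z / poly D z) holomorphic_on ball z r"
        unfolding W_def by (intro holomorphic_intros) auto
      show "h holomorphic_on ball z r"
        using U(3) r(2) W unfolding W_def by (meson holomorphic_on_subset order_trans)
      show "cmod (h w - poly N w / poly D w) < B" if "w \<in> ball z r" for w
      proof -
        have "w \<in> W"
          using that unfolding W_def .
        then show ?thesis
          using PQ(2)[OF subsetD[OF W]] quot[OF Q] by simp
      qed
    qed (rule r(1))
    moreover have "cmod ((deriv ^^ l) (\<lambda>z. poly N z / poly D z) z - (deriv ^^ l) g z) \<le> e / 2"
      using k[OF l zK] unfolding g_def by (simp add: dist_norm norm_minus_commute)
    ultimately show "cmod (A_infty_deriv \<Omega> l f z - A_infty_deriv \<Omega> l (restrict g \<Omega>) z) \<le> e"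
      using norm_triangle_ineq[of "(deriv ^^ l) h z - (deriv ^^ l) (\<lambda>z. poly N z / poly D z) z"
          "(deriv ^^ l) (\<lambda>z. poly N z / poly D z) z - (deriv ^^ l) g z"] by simp
  qed
  then show ?thesis
    using gB by blast
qed

theorem theorem4p2:
  fixes \<Omega> :: "complex set" and F :: "(nat \<times> nat) set"
    and X :: "(complex \<Rightarrow> complex) set"
  assumes "open \<Omega>" and "0 \<in> \<Omega>"
    and "\<exists>p q :: nat \<Rightarrow> nat. (\<forall>m. (p m, q m) \<in> F) \<and>
           filterlim p at_top sequentially \<and> filterlim q at_top sequentially"
    and "X = A_infty_topology \<Omega> closure_of H_closure \<Omega>"
  shows "gdelta_in (subtopology (A_infty_topology \<Omega>) X) (B_F \<Omega> F \<inter> X) \<and>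
    subtopology (A_infty_topology \<Omega>) X closure_of (B_F \<Omega> F \<inter> X) = X \<and>
    B_F \<Omega> F \<noteq> {}"
proof -
  interpret A: Metric_space "A_infty \<Omega>" "A_infty_rho \<Omega>"
    by (rule Metric_space_A_infty[OF assms(1,2)])
  define T where "T = A_infty_topology \<Omega>"
  have HA: "H_closure \<Omega> \<subseteq> A_infty \<Omega>"
    by (rule H_closure_subset_A_infty[OF assms(1)])
  then have HX: "H_closure \<Omega> \<subseteq> X"
    unfolding assms(4) A_infty_topology_def by (intro closure_of_subset) simp
  \<comment> \<open>The approximants remain in \<open>H_closure \<Omega>\<close>, hence in
    \<open>X\<close>. As \<open>X\<close> is the closure of \<open>H_closure \<Omega>\<close>,
    idempotence of the closure extends the inclusion to \<open>X\<close>.\<close>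
  have dense: "H_closure \<Omega> \<subseteq> T closure_of (B_F \<Omega> F \<inter> H_closure \<Omega>)"
  proof
    fix f assume f: "f \<in> H_closure \<Omega>"
    have "\<exists>g. g \<in> B_F \<Omega> F \<inter> H_closure \<Omega> \<and> (\<forall>l\<le>k. A_infty_dist_ln \<Omega> l k f g \<le> inverse (real (Suc k)))" for k
      using H_closure_approx[OF assms(1-3) f, of "inverse (real (Suc k))" k] by auto
    then obtain g where g: "\<And>k. g k \<in> B_F \<Omega> F \<inter> H_closure \<Omega>"
      "\<And>k l. l \<le> k \<Longrightarrow> A_infty_dist_ln \<Omega> l k f (g k) \<le> inverse (real (Suc k))"
      by metis
    have A: "f \<in> A_infty \<Omega>" "g k \<in> A_infty \<Omega>" for k
      using f g(1) HA by blast+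
    have "(\<lambda>k. A_infty_dist_ln \<Omega> l (Suc n) f (g k)) \<longlonglongrightarrow> 0" for l n
    proof (rule tendsto_sandwich[OF _ _ tendsto_const LIMSEQ_inverse_real_of_nat])
      show "\<forall>\<^sub>F k in sequentially. A_infty_dist_ln \<Omega> l (Suc n) f (g k) \<le> inverse (real (Suc k))"
        using eventually_ge_at_top[of "max l (Suc n)"]
      proof eventually_elim
        case (elim k)
        \<comment> \<open>The supremum grows with the radius, so index \<open>k\<close> controls
          every radius up to \<open>k\<close>.\<close>
        have "A_infty_dist_ln \<Omega> l (Suc n) f (g k) \<le> A_infty_dist_ln \<Omega> l k f (g k)"
          using elim by (intro A_infty_dist_ln_least[OF assms(2)] A_infty_dist_ln_upper[OF assms(1) A]) auto
        then show ?case
          using g(2)[of l k] elim by simp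
      qed
    qed (simp add: A_infty_dist_ln_nonneg[OF assms(1,2) A])
    then have lim: "(\<lambda>k. A_infty_rho \<Omega> f (g k)) \<longlonglongrightarrow> 0"
      by (rule A_infty_rho_tendsto_0[OF assms(1,2) A])
    show "f \<in> T closure_of (B_F \<Omega> F \<inter> H_closure \<Omega>)"
      unfolding T_def A_infty_topology_def A.metric_closure_of
    proof (intro CollectI conjI allI impI)
      fix r :: real assume "r > 0"
      then have "\<forall>\<^sub>F k in sequentially. A_infty_rho \<Omega> f (g k) < r"
        by (rule order_tendstoD(2)[OF lim])
      then obtain k where "A_infty_rho \<Omega> f (g k) < r"
        using eventually_happens'[OF sequentially_bot] by blast
      then show "\<exists>y\<in>B_F \<Omega> F \<inter> H_closure \<Omega>. y \<in> A.mball f r"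
        using g(1) A by (auto simp: A.in_mball)
    qed (rule A(1))
  qed
  have "X \<subseteq> T closure_of (B_F \<Omega> F \<inter> H_closure \<Omega>)"
    unfolding assms(4) T_def[symmetric] using closure_of_mono[OF dense, of T] by simp
  also have "\<dots> \<subseteq> T closure_of (B_F \<Omega> F \<inter> X)"
    using HX by (intro closure_of_mono) auto
  finally have "X \<subseteq> T closure_of (B_F \<Omega> F \<inter> X)" .
  then have "subtopology T X closure_of (B_F \<Omega> F \<inter> X) = X"
    by (simp add: closure_of_subtopology Int_absorb1 Int_commute inf.absorb1)
  moreover have "gdelta_in (subtopology T X) (B_F \<Omega> F \<inter> X)"
    using gdelta_in_B_F[OF assms(1,2)] unfolding T_def gdelta_in_subtopology by blast
  \<comment> \<open>A point of \<open>H_closure \<Omega>\<close> lies in the closure of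
    \<open>B_F \<Omega> F \<inter> H_closure \<Omega>\<close>, which would be empty if
    \<open>B_F \<Omega> F\<close> were.\<close>
  moreover have "restrict (\<lambda>_. 0) \<Omega> \<in> H_closure \<Omega>"
    unfolding H_closure_def by (auto intro!: exI[of _ "\<lambda>_. 0"] exI[of _ UNIV])
  then have "T closure_of (B_F \<Omega> F \<inter> H_closure \<Omega>) \<noteq> {}"
    using dense by blast
  then have "B_F \<Omega> F \<noteq> {}"
    by auto
  ultimately show ?thesis
    unfolding T_def by blast
qed

end
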